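(* For every integer $n\ge 4$, with $\gamma_n$ defined as in the context, we have $\gamma_n\ge 1$.
   Context: For an integer $n\ge 1$ and real $H\ge 1$, $\mathcal{M}_n(\mathbb{Z};H)$ is the set of $n\times n$ matrices with integer entries of absolute value at most $H$. For a polynomial $f\in\mathbb{Z}[X]$ (monic of degree $n$), $R_n(H;f)$ is the number of matrices $A\in\mathcal{M}_n(\mathbb{Z};H)$ with characteristic polynomial $\det(XI_n-A)=f(X)$. The number $\gamma_n$ is defined as the largest real number such that, uniformly over polynomials $f$, $R_n(H;f)\le H^{n^2-n-\gamma_n+o(1)}$ as $H\to\infty$. Explicitly, $\gamma_n$ is the largest real $\gamma$ such that for every $\varepsilon>0$ there is $H_0=H_0(n,\varepsilon)$ with $R_n(H;f)\le H^{n^2-n-\gamma+\varepsilon}$ for all $H\ge H_0$ and all monic $f\in\mathbb{Z}[X]$ of degree $n$. *)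

theory Defs
  imports Complex_Main "Jordan_Normal_Form.Char_Poly"
begin

definition bounded_int_mats :: "nat \<Rightarrow> real \<Rightarrow> int mat set" where
  "bounded_int_mats n H =
     {A \<in> carrier_mat n n. \<forall>i<n. \<forall>j<n. \<bar>real_of_int (A $$ (i, j))\<bar> \<le> H}"

text \<open>The cardinality below is the genuine number of matrices, since the set is finite.\<close>

lemma finite_bounded_int_mats: "finite (bounded_int_mats n H)"
proof -
  let ?B = "{- \<lfloor>H\<rfloor> .. \<lfloor>H\<rfloor>}"
  let ?F = "{f. \<forall>p. (p \<in> {..<n} \<times> {..<n} \<longrightarrow> f p \<in> ?B) \<and> (p \<notin> {..<n} \<times> {..<n} \<longrightarrow> f p = (0::int))}"
  have "finite ?F"
    by (rule finite_set_of_finite_funs) auto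
  moreover have "bounded_int_mats n H \<subseteq> (\<lambda>f. mat n n f) ` ?F"
  proof
    fix A assume A: "A \<in> bounded_int_mats n H"
    let ?f = "\<lambda>p. if p \<in> {..<n} \<times> {..<n} then A $$ p else 0"
    have "A = mat n n ?f"
      using A by (intro eq_matI) (auto simp: bounded_int_mats_def)
    moreover have "?f \<in> ?F"
      using A by (auto simp: bounded_int_mats_def le_floor_iff abs_le_iff)
        (smt (verit) le_floor_iff of_int_minus)
    ultimately show "A \<in> (\<lambda>f. mat n n f) ` ?F" by blast
  qed
  ultimately show ?thesis by (rule finite_surj)
qed

definition num_mats_char_poly :: "nat \<Rightarrow> real \<Rightarrow> int poly \<Rightarrow> nat" where
  "num_mats_char_poly n H f = card {A \<in> bounded_int_mats n H. char_poly A = f}"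

text \<open>Uniformity in the polynomial: the threshold \<open>H\<^sub>0\<close> depends on \<open>n\<close> and \<open>\<epsilon>\<close> only.\<close>

definition admissible_saving :: "nat \<Rightarrow> real \<Rightarrow> bool" where
  "admissible_saving n g \<longleftrightarrow>
     (\<forall>\<epsilon>>0. \<exists>H\<^sub>0\<ge>1. \<forall>H\<ge>H\<^sub>0. \<forall>f :: int poly. monic f \<and> degree f = n \<longrightarrow>
        real (num_mats_char_poly n H f) \<le> H powr (real n ^ 2 - real n - g + \<epsilon>))"

definition gamma_exponent :: "nat \<Rightarrow> real" where
  "gamma_exponent n = (GREATEST g. admissible_saving n g)"

end

theory Submission
  imports Defs
begin

text \<open>
  Write \<open>P\<close> for the determinant of the Krylov matrix with columns \<open>A^j e\<^sub>0\<close>, \<open>Q\<close> for that of the transpose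
  of \<open>A\<close>, and \<open>M\<close> for the minor of \<open>A\<close> without row and column \<open>0\<close>.

  The matrices with \<open>P = 0\<close> are counted in classes modulo the space \<open>U\<close> of matrices with an arbitrary
  diagonal and a constant subdiagonal. The top degree forms of the equations \<open>char_poly A = f\<close> and
  \<open>P = 0\<close> have only the trivial common zero on \<open>U\<close>, because a nilpotent element of \<open>U\<close> is a multiple
  \<open>x\<close> of the shift and \<open>P\<close> is then a power of \<open>x\<close>. So every class contains boundedly many solutions,
  and there are \<open>O(H^(n^2 - n - 1))\<close> classes. Transposition deals with \<open>Q = 0\<close>.

  If \<open>P\<close> and \<open>Q\<close> are nonzero, then \<open>P Q\<close> is the Hankel determinant of the moments \<open>(A^k)\<^sub>0\<^sub>0\<close>, which are
  determined by \<open>f\<close> and \<open>M\<close>. The divisor bound leaves \<open>H^o(1)\<close> values of \<open>P\<close> for every \<open>M\<close>. As a function of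
  the first column, \<open>P\<close> is a polynomial vanishing at \<open>0\<close>, so each nonzero value is taken
  by \<open>O(H^(n - 2))\<close> columns. Finally the moments and the first column determine the first row.
\<close>

section \<open>Krylov matrices and moments\<close>

text \<open>\<open>kry n a j i\<close> is the entry \<open>(i, 0)\<close> of the \<open>j\<close>-th power of the \<open>n \<times> n\<close> matrix \<open>a\<close>.\<close>

fun kry :: "nat \<Rightarrow> (nat \<Rightarrow> nat \<Rightarrow> 'a::comm_ring_1) \<Rightarrow> nat \<Rightarrow> nat \<Rightarrow> 'a" where
  "kry n a 0 i = (if i = 0 then 1 else 0)"
| "kry n a (Suc j) i = (\<Sum>k<n. a i k * kry n a j k)"

definition kmat :: "nat \<Rightarrow> (nat \<Rightarrow> nat \<Rightarrow> 'a::comm_ring_1) \<Rightarrow> 'a mat" where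
  "kmat n a = mat n n (\<lambda>(i, j). kry n a j i)"

definition kdet :: "nat \<Rightarrow> (nat \<Rightarrow> nat \<Rightarrow> 'a::comm_ring_1) \<Rightarrow> 'a" where
  "kdet n a = det (kmat n a)"

lemma kmat_carrier [simp]: "kmat n a \<in> carrier_mat n n"
  by (simp add: kmat_def)

lemma (in comm_ring_hom) hom_kry: "hom (kry n a j i) = kry n (\<lambda>i j. hom (a i j)) j i"
  by (induction j arbitrary: i) (simp_all add: hom_distribs)

lemma (in comm_ring_hom) hom_kdet: "hom (kdet n a) = kdet n (\<lambda>i j. hom (a i j))"
proof -
  have "hom (kdet n a) = det (map_mat hom (kmat n a))"
    by (simp add: kdet_def)
  also have "map_mat hom (kmat n a) = kmat n (\<lambda>i j. hom (a i j))"
    by (rule eq_matI) (simp_all add: kmat_def hom_kry)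
  finally show ?thesis by (simp add: kdet_def)
qed

lemma kry_cong:
  assumes "\<And>i j. i < n \<Longrightarrow> j < n \<Longrightarrow> a i j = b i j" "i < n"
  shows "kry n a j i = kry n b j i"
  using assms(2)
proof (induction j arbitrary: i)
  case (Suc j)
  then show ?case by (auto intro!: sum.cong simp: assms(1))
qed auto

lemma kdet_cong:
  assumes "\<And>i j. i < n \<Longrightarrow> j < n \<Longrightarrow> a i j = b i j"
  shows "kdet n a = kdet n b"
  unfolding kdet_def kmat_def by (rule arg_cong[where f = det], rule eq_matI)
    (auto intro: kry_cong assms)

text \<open>Row \<open>0\<close> of the \<open>i\<close>-th power is paired with column
  \<open>0\<close> of the \<open>j\<close>-th power. Each induction step moves one factor of
  \<open>a\<close> to the right, so \<open>j\<close> must be arbitrary.\<close>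

lemma kry_hankel:
  assumes "0 < n"
  shows "(\<Sum>k<n. kry n (\<lambda>i j. a j i) i k * kry n a j k) = kry n a (i + j) 0"
proof (induction i arbitrary: j)
  case 0
  have "(\<Sum>k<n. kry n (\<lambda>i j. a j i) 0 k * kry n a j k) = (\<Sum>k<n. if k = 0 then kry n a j k else 0)"
    by (rule sum.cong) auto
  then show ?case using assms by (simp add: sum.delta)
next
  case (Suc i)
  have "(\<Sum>k<n. kry n (\<lambda>i j. a j i) (Suc i) k * kry n a j k)
      = (\<Sum>k<n. \<Sum>l<n. a l k * kry n (\<lambda>i j. a j i) i l * kry n a j k)"
    by (simp add: sum_distrib_right)
  also have "\<dots> = (\<Sum>l<n. \<Sum>k<n. a l k * kry n (\<lambda>i j. a j i) i l * kry n a j k)"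
    by (rule sum.swap)
  also have "\<dots> = (\<Sum>l<n. kry n (\<lambda>i j. a j i) i l * kry n a (Suc j) l)"
    by (simp add: sum_distrib_left mult_ac)
  also have "\<dots> = kry n a (Suc i + j) 0" using Suc.IH[of "Suc j"] by simp
  finally show ?case .
qed

text \<open>The transposed Krylov matrix of the transpose times the Krylov matrix of
  \<open>a\<close> is the Hankel matrix of the moments.\<close>

lemma kdet_hankel:
  assumes "0 < n"
  shows "kdet n (\<lambda>i j. a j i) * kdet n a = det (mat n n (\<lambda>(i, j). kry n a (i + j) 0))"
proof -
  let ?L = "kmat n (\<lambda>i j. a j i)"
  have "transpose_mat ?L * kmat n a = mat n n (\<lambda>(i, j). kry n a (i + j) 0)"
    using kry_hankel[OF assms, of a]
    by (intro eq_matI) (simp_all add: kmat_def scalar_prod_def lessThan_atLeast0)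
  moreover have "det (transpose_mat ?L * kmat n a) = det ?L * det (kmat n a)"
    by (subst det_mult[of _ n]) (simp_all add: det_transpose[of _ n])
  ultimately show ?thesis by (simp add: kdet_def)
qed

text \<open>The Krylov vectors of \<open>a\<close> arise from those of the matrix with vanishing first row by
  a unitriangular Toeplitz transformation.\<close>

lemma kry_zero_row:
  fixes a :: "nat \<Rightarrow> nat \<Rightarrow> 'a::comm_ring_1"
  assumes "i < n"
  defines "z \<equiv> \<lambda>i j. if i = 0 then 0 else a i j"
  shows "kry n a j i = kry n z j i + (\<Sum>l<j. kry n a (j - l) 0 * kry n z l i)"
  using assms(1)
proof (induction j arbitrary: i)
  case (Suc j)
  let ?K = "kry n a" and ?Z = "kry n z"
  have split: "a i k * x = z i k * x + (if i = 0 then a 0 k * x else 0)" for k x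
    by (simp add: z_def)
  have "?K (Suc j) i = (\<Sum>k<n. z i k * ?K j k) + (if i = 0 then ?K (Suc j) 0 else 0)"
    by (simp add: split sum.distrib)
  also have "(\<Sum>k<n. z i k * ?K j k)
      = (\<Sum>k<n. z i k * (?Z j k + (\<Sum>l<j. ?K (j - l) 0 * ?Z l k)))"
    using Suc.IH by (intro sum.cong) auto
  also have "\<dots> = ?Z (Suc j) i + (\<Sum>k<n. \<Sum>l<j. z i k * (?K (j - l) 0 * ?Z l k))"
    by (simp add: algebra_simps sum.distrib sum_distrib_left)
  also have "(\<Sum>k<n. \<Sum>l<j. z i k * (?K (j - l) 0 * ?Z l k)) = (\<Sum>l<j. ?K (j - l) 0 * ?Z (Suc l) i)"
    by (subst sum.swap) (simp add: sum_distrib_left mult_ac)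
  finally have "?K (Suc j) i = ?Z (Suc j) i +
     ((if i = 0 then ?K (Suc j) 0 else 0) + (\<Sum>l<j. ?K (j - l) 0 * ?Z (Suc l) i))"
    by (simp only: ac_simps)
  \<comment> \<open>\<open>?Z 0 i\<close> is \<open>1\<close> for \<open>i = 0\<close> and
    \<open>0\<close> otherwise, so the contribution of row \<open>0\<close> is the summand
    \<open>l = 0\<close>.\<close>
  also have "(if i = 0 then ?K (Suc j) 0 else 0) + (\<Sum>l<j. ?K (j - l) 0 * ?Z (Suc l) i)
      = (\<Sum>l<Suc j. ?K (Suc j - l) 0 * ?Z l i)"
    by (subst sum.lessThan_Suc_shift) simp
  finally show ?case .
qed simp

text \<open>The unitriangular factor \<open>T\<close> has determinant \<open>1\<close>. Hence the
  Krylov determinant depends only on the rows below the first, and its level sets can be counted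
  while the first row is unknown.\<close>

lemma kdet_zero_row: "kdet n a = kdet n (\<lambda>i j. if i = 0 then 0 else a i j)"
proof -
  define z where "z = (\<lambda>i j. if i = 0 then 0 else a i j)"
  define T where "T = mat n n (\<lambda>(l, j). if l < j then kry n a (j - l) 0 else if l = j then 1 else 0)"
  have T: "T \<in> carrier_mat n n" by (simp add: T_def)
  have "kmat n a = kmat n z * T"
  proof (rule eq_matI)
    fix i j assume "i < dim_row (kmat n z * T)" "j < dim_col (kmat n z * T)"
    then have ij: "i < n" "j < n" by (auto simp: kmat_def T_def)
    have "(kmat n z * T) $$ (i, j)
        = (\<Sum>l<n. kry n z l i * (if l < j then kry n a (j - l) 0 else if l = j then 1 else 0))"
      using ij by (simp add: kmat_def T_def scalar_prod_def lessThan_atLeast0)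
    also have "\<dots> = (\<Sum>l\<in>insert j {..<j}. kry n z l i * (if l < j then kry n a (j - l) 0 else 1))"
      using ij by (intro sum.mono_neutral_cong_right) auto
    also have "\<dots> = kry n z j i + (\<Sum>l<j. kry n a (j - l) 0 * kry n z l i)"
      by (subst sum.insert) (auto intro!: sum.cong)
    also have "\<dots> = kry n a j i" using kry_zero_row[OF ij(1), of a j] by (simp add: z_def)
    finally show "kmat n a $$ (i, j) = (kmat n z * T) $$ (i, j)"
      using ij by (simp add: kmat_def)
  qed (auto simp: kmat_def T_def)
  moreover have "det T = 1"
  proof -
    have "upper_triangular T" by (auto simp: upper_triangular_def T_def)
    then have "det T = prod_list (diag_mat T)" by (rule det_upper_triangular[OF _ T])
    also have "\<dots> = 1" by (simp add: prod_list_diag_prod T_def)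
    finally show ?thesis .
  qed
  ultimately show ?thesis
    using det_mult[OF kmat_carrier T, of z] by (simp add: kdet_def z_def)
qed

text \<open>For \<open>n >= 2\<close> the Krylov matrix has a column \<open>1\<close>, and this is
  column \<open>0\<close> of \<open>a\<close>.\<close>

lemma kdet_zero_column:
  assumes "2 \<le> n" "\<And>i. i < n \<Longrightarrow> a i 0 = 0"
  shows "kdet n a = 0"
proof -
  have "kry n a 1 i = 0" if "i < n" for i
    using assms that by (auto intro!: sum.neutral)
  then have c: "kmat n a $$ (i, 1) = 0" if "i < n" for i
    using that assms(1) by (simp add: kmat_def)
  have "col (kmat n a) 1 = 0\<^sub>v n"
    using c assms(1) by (intro eq_vecI) (auto simp: kmat_def)
  then have r: "row (transpose_mat (kmat n a)) 1 = 0\<^sub>v n"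
    using assms(1) by (subst row_transpose) (auto simp: kmat_def)
  have "det (transpose_mat (kmat n a)) = 0"
    unfolding det_def'[of "transpose_mat (kmat n a)" n, simplified]
  proof (intro sum.neutral ballI)
    fix p assume "p \<in> {p. p permutes {0..<n}}"
    then have "p 1 < n" using assms(1) by (auto dest: permutes_in_image[of p _ 1])
    then have "transpose_mat (kmat n a) $$ (1, p 1) = 0"
      using c assms(1) by (simp add: kmat_def)
    then have "(\<Prod>i = 0..<n. transpose_mat (kmat n a) $$ (i, p i)) = 0"
      using assms(1) by (intro prod_zero) (auto intro!: bexI[of _ 1])
    then show "signof p * (\<Prod>i = 0..<n. transpose_mat (kmat n a) $$ (i, p i)) = 0" by simp
  qed
  then show ?thesis by (simp add: kdet_def det_transpose[of _ n])
qed

text \<open>The Krylov vectors of \<open>a\<close> and \<open>b\<close> agree: entry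
  \<open>0\<close> is a moment, and the other entries follow recursively from the common rows. The
  difference of the first rows is then orthogonal to all Krylov vectors, which are linearly
  independent.\<close>

lemma kdet_inj:
  fixes a b :: "nat \<Rightarrow> nat \<Rightarrow> 'a::idom"
  assumes "0 < n" "kdet n a \<noteq> 0"
    and rows: "\<And>i j. 0 < i \<Longrightarrow> i < n \<Longrightarrow> j < n \<Longrightarrow> a i j = b i j"
    and moments: "\<And>j. j \<le> n \<Longrightarrow> kry n a j 0 = kry n b j 0"
    and "i < n" "j < n"
  shows "a i j = b i j"
proof -
  have eq: "kry n a j i = kry n b j i" if "i < n" "j \<le> n" for i j
    using that
  proof (induction j arbitrary: i)
    case (Suc j)
    show ?case
    proof (cases "i = 0")
      case True
      then show ?thesis using moments[OF Suc.prems(2)] by (simp only:)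
    next
      case False
      then show ?thesis using Suc rows by (auto intro!: sum.cong)
    qed
  qed auto
  have "a 0 j = b 0 j" if "j < n" for j
  proof -
    define v where "v = vec n (\<lambda>k. a 0 k - b 0 k)"
    have v: "v \<in> carrier_vec n" by (simp add: v_def)
    have "transpose_mat (kmat n a) *\<^sub>v v = 0\<^sub>v n"
    proof (rule eq_vecI)
      fix j assume j: "j < dim_vec (0\<^sub>v n)"
      then have j: "j < n" by simp
      have "(transpose_mat (kmat n a) *\<^sub>v v) $ j = (\<Sum>k<n. kry n a j k * (a 0 k - b 0 k))"
        using j by (simp add: v_def kmat_def scalar_prod_def lessThan_atLeast0)
      also have "\<dots> = kry n a (Suc j) 0 - (\<Sum>k<n. b 0 k * kry n a j k)"
        by (simp add: algebra_simps sum_subtractf)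
      also have "(\<Sum>k<n. b 0 k * kry n a j k) = kry n b (Suc j) 0"
        using eq j by (auto intro!: sum.cong)
      \<comment> \<open>For the last Krylov vector, \<open>j = n - 1\<close>, this uses the moment
        of index \<open>n\<close>.\<close>
      also have "kry n a (Suc j) 0 - kry n b (Suc j) 0 = 0"
        using moments[of "Suc j"] j by (simp del: kry.simps)
      finally show "(transpose_mat (kmat n a) *\<^sub>v v) $ j = 0\<^sub>v n $ j" using j by simp
    qed (simp add: kmat_def)
    moreover have "det (transpose_mat (kmat n a)) \<noteq> 0"
      using assms(2) by (simp add: kdet_def det_transpose[of _ n])
    ultimately have "v = 0\<^sub>v n"
      using det_0_iff_vec_prod_zero[of "transpose_mat (kmat n a)" n] v by auto
    then have "v $ j = 0" using that by simp
    then show ?thesis using that by (simp add: v_def)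
  qed
  then show ?thesis using rows[of i j] assms(5,6) by (cases "i = 0") auto
qed

section \<open>The resolvent and the generating function of the moments\<close>

lemma char_poly_matrix_index:
  assumes "A \<in> carrier_mat n n" "i < n" "j < n"
  shows "char_poly_matrix A $$ (i, j) = (if i = j then [:0, 1:] else 0) - [:A $$ (i, j):]"
  using assms by (auto simp: char_poly_matrix_def)

text \<open>In Horner form, column \<open>0\<close> of the sum of \<open>X^(N - 1 - l) A^l\<close>
  over \<open>l < N\<close>. This is the polynomial part of \<open>X^N\<close> times the
  resolvent.\<close>

fun krysum :: "nat \<Rightarrow> (nat \<Rightarrow> nat \<Rightarrow> 'a::comm_ring_1) \<Rightarrow> nat \<Rightarrow> nat \<Rightarrow> 'a poly" where
  "krysum n a 0 i = 0"
| "krysum n a (Suc N) i = [:0, 1:] * krysum n a N i + [:kry n a N i:]"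

lemma sum_const_poly: "(\<Sum>k\<in>S. [:f k:]) = [:\<Sum>k\<in>S. f k:]"
  by (induction S rule: infinite_finite_induct) auto

text \<open>The product of \<open>X - A\<close> with that sum telescopes to
  \<open>X^N - A^N\<close>; this is column \<open>0\<close> of the identity.\<close>

lemma resolvent_krysum:
  "[:0, 1:] * krysum n a N i - (\<Sum>k<n. [:a i k:] * krysum n a N k)
     = (if i = 0 then [:0, 1:] ^ N else 0) - [:kry n a N i:]"
proof (induction N)
  case (Suc N)
  let ?X = "[:0, 1:] :: 'a poly" and ?s = "krysum n a"
  have "(\<Sum>k<n. [:a i k:] * ?s (Suc N) k)
      = ?X * (\<Sum>k<n. [:a i k:] * ?s N k) + (\<Sum>k<n. [:a i k:] * [:kry n a N k:])"
    unfolding krysum.simps distrib_left sum.distrib sum_distrib_left by (simp only: mult.left_commute)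
  also have "(\<Sum>k<n. [:a i k:] * [:kry n a N k:]) = [:kry n a (Suc N) i:]"
    by (simp add: sum_const_poly mult.commute)
  finally have "?X * ?s (Suc N) i - (\<Sum>k<n. [:a i k:] * ?s (Suc N) k)
      = ?X * (?X * ?s N i - (\<Sum>k<n. [:a i k:] * ?s N k)) + ?X * [:kry n a N i:] - [:kry n a (Suc N) i:]"
    unfolding krysum.simps by (simp only: algebra_simps)
  also have "\<dots> = ?X * ((if i = 0 then ?X ^ N else 0) - [:kry n a N i:])
      + ?X * [:kry n a N i:] - [:kry n a (Suc N) i:]"
    by (simp only: Suc.IH)
  also have "\<dots> = (if i = 0 then ?X ^ Suc N else 0) - [:kry n a (Suc N) i:]"
    by (cases "i = 0") (simp_all only: algebra_simps power_Suc if_True if_False mult_zero_right, auto)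
  finally show ?case .
qed simp

text \<open>Row \<open>0\<close> of the adjugate of \<open>X - A\<close>, applied to
  \<open>resolvent_krysum\<close>, replaces \<open>X - A\<close> by \<open>char_poly A\<close>. The
  subtracted sum has degree below \<open>n\<close> and acts as a remainder.\<close>

lemma char_poly_krysum:
  fixes A :: "'a::comm_ring_1 mat"
  assumes A: "A \<in> carrier_mat n n" and "0 < n"
  defines "a \<equiv> \<lambda>i j. A $$ (i, j)"
  defines "C \<equiv> \<lambda>i. cofactor (char_poly_matrix A) i 0"
  shows "char_poly A * krysum n a N 0 = [:0, 1:] ^ N * C 0 - (\<Sum>i<n. C i * [:kry n a N i:])"
proof -
  let ?M = "char_poly_matrix A" and ?s = "krysum n a N"
  have M: "?M \<in> carrier_mat n n" using A by simp
  have adj: "(\<Sum>i<n. C i * ?M $$ (i, k)) = (if k = 0 then char_poly A else 0)" if "k < n" for k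
  proof -
    have "(adj_mat ?M * ?M) $$ (0, k) = (\<Sum>i<n. C i * ?M $$ (i, k))"
      using that M \<open>0 < n\<close> adj_mat(1)[OF M]
      by (simp add: scalar_prod_def lessThan_atLeast0 adj_mat_def C_def)
    then show ?thesis
      using that \<open>0 < n\<close> unfolding adj_mat(3)[OF M] by (auto simp: char_poly_def)
  qed
  have row: "(\<Sum>k<n. ?M $$ (i, k) * ?s k) = (if i = 0 then [:0, 1:] ^ N else 0) - [:kry n a N i:]"
    if "i < n" for i
  proof -
    have "(\<Sum>k<n. ?M $$ (i, k) * ?s k)
        = (\<Sum>k<n. (if k = i then [:0, 1:] * ?s k else 0) - [:a i k:] * ?s k)"
      using that by (intro sum.cong refl)
        (auto simp: char_poly_matrix_index[OF A] a_def algebra_simps)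
    also have "\<dots> = [:0, 1:] * ?s i - (\<Sum>k<n. [:a i k:] * ?s k)"
      using that by (simp only: sum_subtractf sum.delta finite_lessThan lessThan_iff if_True)
    finally show ?thesis by (simp only: resolvent_krysum)
  qed
  have "char_poly A * ?s 0 = (\<Sum>k<n. if k = 0 then char_poly A * ?s k else 0)"
    using \<open>0 < n\<close> by (simp add: sum.delta)
  also have "\<dots> = (\<Sum>k<n. (\<Sum>i<n. C i * ?M $$ (i, k)) * ?s k)"
    using adj by (intro sum.cong) auto
  also have "\<dots> = (\<Sum>i<n. C i * (\<Sum>k<n. ?M $$ (i, k) * ?s k))"
    unfolding sum_distrib_left sum_distrib_right by (subst sum.swap) (simp only: mult.assoc)
  also have "\<dots> = (\<Sum>i<n. (if i = 0 then [:0, 1:] ^ N * C i else 0) - C i * [:kry n a N i:])"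
    by (intro sum.cong refl, simp only: row lessThan_iff) (simp only: right_diff_distrib mult_zero_right mult.commute split: if_splits, auto)
  also have "\<dots> = [:0, 1:] ^ N * C 0 - (\<Sum>i<n. C i * [:kry n a N i:])"
    using \<open>0 < n\<close> by (simp only: sum_subtractf sum.delta finite_lessThan lessThan_iff if_True)
  finally show ?thesis .
qed

lemma degree_cofactor_char_poly_matrix:
  assumes A: "A \<in> carrier_mat n n" and "i < n" "j < n"
  shows "degree (cofactor (char_poly_matrix A) i j) < n"
proof -
  let ?D = "mat_delete (char_poly_matrix A) i j"
  have D: "?D \<in> carrier_mat (n - 1) (n - 1)"
    using A by (auto simp: mat_delete_def char_poly_matrix_def)
  have ent: "degree (?D $$ (k, l)) \<le> 1" if "k < n - 1" "l < n - 1" for k l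
  proof -
    have "degree (char_poly_matrix A $$ (k', l')) \<le> 1" if "k' < n" "l' < n" for k' l'
      using that by (auto simp: char_poly_matrix_index[OF A])
    then show ?thesis
      using that carrier_matD[OF char_poly_matrix_closed[OF A]] by (auto simp: mat_delete_def)
  qed
  have "degree (det ?D) \<le> 1 * (n - 1)" by (rule degree_det_le[OF ent D])
  moreover have "degree ((-1) ^ (i + j) * det ?D) \<le> degree (det ?D)"
    by (cases "even (i + j)") auto
  ultimately show ?thesis using assms(2) by (simp add: cofactor_def)
qed

text \<open>The generating function of the moments \<open>(A^k)\<^sub>0\<^sub>0\<close> is the \<open>(0,0)\<close> entry of the resolvent,
  that is, the characteristic polynomial of the minor divided by that of \<open>A\<close>.\<close>

lemma moments_eq:
  fixes A B :: "'a::idom mat"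
  assumes A: "A \<in> carrier_mat n n" and B: "B \<in> carrier_mat n n" and "0 < n"
    and char: "char_poly A = char_poly B"
    and minor: "\<And>i j. 0 < i \<Longrightarrow> i < n \<Longrightarrow> 0 < j \<Longrightarrow> j < n \<Longrightarrow> A $$ (i, j) = B $$ (i, j)"
  shows "kry n (\<lambda>i j. A $$ (i, j)) N 0 = kry n (\<lambda>i j. B $$ (i, j)) N 0"
proof -
  let ?a = "\<lambda>i j. A $$ (i, j)" and ?b = "\<lambda>i j. B $$ (i, j)"
  let ?C = "\<lambda>A i. cofactor (char_poly_matrix A) i 0"
  \<comment> \<open>The cofactor at \<open>(0, 0)\<close> is the characteristic polynomial of the
    minor.\<close>
  have C0: "?C A 0 = ?C B 0"
  proof -
    have dim: "dim_row (char_poly_matrix M) = n" "dim_col (char_poly_matrix M) = n"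
      if "M \<in> carrier_mat n n" for M :: "'a mat"
      using that by (auto simp: char_poly_matrix_def)
    have "mat_delete (char_poly_matrix A) 0 0 = mat_delete (char_poly_matrix B) 0 0"
    proof (rule eq_matI)
      fix i j
      assume "i < dim_row (mat_delete (char_poly_matrix B) 0 0)"
        and "j < dim_col (mat_delete (char_poly_matrix B) 0 0)"
      then have ij: "i < n - 1" "j < n - 1" using dim[OF B] by (simp_all add: mat_delete_def)
      then have "char_poly_matrix A $$ (Suc i, Suc j) = char_poly_matrix B $$ (Suc i, Suc j)"
        using minor[of "Suc i" "Suc j"]
        by (simp add: char_poly_matrix_index[OF A] char_poly_matrix_index[OF B])
      then show "mat_delete (char_poly_matrix A) 0 0 $$ (i, j) = mat_delete (char_poly_matrix B) 0 0 $$ (i, j)"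
        using ij dim[OF A] dim[OF B] by (simp add: mat_delete_def)
    qed (use dim[OF A] dim[OF B] in \<open>simp_all add: mat_delete_def\<close>)
    then show ?thesis by (simp add: cofactor_def)
  qed
  have deg: "degree (\<Sum>i<n. ?C M i * [:c i:]) < n" if "M \<in> carrier_mat n n" for M :: "'a mat" and c
  proof -
    have "degree (\<Sum>i<n. ?C M i * [:c i:]) \<le> n - 1"
    proof (rule degree_sum_le)
      fix i assume "i \<in> {..<n}"
      then have "degree (?C M i) < n"
        using degree_cofactor_char_poly_matrix[OF that] \<open>0 < n\<close> by auto
      moreover have "degree (?C M i * [:c i:]) \<le> degree (?C M i)"
        using degree_mult_le[of "?C M i" "[:c i:]"] by simp
      ultimately show "degree (?C M i * [:c i:]) \<le> n - 1" by simp
    qed simp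
    then show ?thesis using \<open>0 < n\<close> by simp
  qed
  \<comment> \<open>The terms with a power of \<open>X\<close> cancel, so
    \<open>char_poly A * S\<close> is a difference of remainders of degree below \<open>n\<close>,
    which forces \<open>S = 0\<close>. The moment of index \<open>N\<close> is the constant
    coefficient of \<open>krysum\<close> at \<open>Suc N\<close>.\<close>
  define S where "S = krysum n ?a (Suc N) 0 - krysum n ?b (Suc N) 0"
  have "char_poly A * S = (\<Sum>i<n. ?C B i * [:kry n ?b (Suc N) i:]) - (\<Sum>i<n. ?C A i * [:kry n ?a (Suc N) i:])"
    unfolding S_def right_diff_distrib char_poly_krysum[OF A \<open>0 < n\<close>]
    by (simp only: char char_poly_krysum[OF B \<open>0 < n\<close>] C0) (simp only: algebra_simps)
  then have "degree (char_poly A * S) < n"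
    using deg[OF A] deg[OF B] by (auto intro: degree_diff_less)
  moreover have "degree (char_poly A) = n" "char_poly A \<noteq> 0"
    using degree_monic_char_poly[OF A] by auto
  ultimately have "S = 0" using degree_mult_eq[of "char_poly A" S] by auto
  then have "coeff (krysum n ?a (Suc N) 0) 0 = coeff (krysum n ?b (Suc N) 0) 0" by (simp add: S_def)
  then show ?thesis by (simp only: krysum.simps) simp
qed

section \<open>Matrices with vanishing Krylov determinant\<close>

text \<open>Gaussian elimination, one equation per induction step, for a homogeneous system with
  more unknowns than equations.\<close>

lemma exists_nontrivial_relation:
  fixes f :: "'b \<Rightarrow> 'a \<Rightarrow> 'k::field"
  assumes "finite B" "finite T" "card B < card T"
  shows "\<exists>l. (\<exists>u\<in>T. l u \<noteq> 0) \<and> (\<forall>b\<in>B. (\<Sum>u\<in>T. l u * f b u) = 0)"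
  using assms
proof (induction B arbitrary: T f rule: finite_induct)
  case empty
  then have "T \<noteq> {}" by auto
  then show ?case by (intro exI[of _ "\<lambda>_. 1"]) auto
next
  case (insert b B)
  show ?case
  proof (cases "\<forall>u\<in>T. f b u = 0")
    case True
    have "card B < card T" using insert by simp
    from insert.IH[OF insert.prems(1) this, of f] obtain l
      where "\<exists>u\<in>T. l u \<noteq> 0" "\<forall>b\<in>B. (\<Sum>u\<in>T. l u * f b u) = 0" by blast
    with True show ?thesis by (intro exI[of _ l]) auto
  next
    case False
    then obtain w where w: "w \<in> T" "f b w \<noteq> 0" by blast
    \<comment> \<open>Equation \<open>b\<close> eliminates the unknown \<open>w\<close> from the
      others. Afterwards \<open>l'\<close> gives \<open>w\<close> the value forced by that
      equation.\<close>
    define f' where "f' = (\<lambda>c u. f c u - f c w * f b u / f b w)"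
    have "card B < card (T - {w})" using insert w by simp
    from insert.IH[OF _ this, of f'] insert.prems(1) obtain l
      where l: "\<exists>u\<in>T - {w}. l u \<noteq> 0" "\<forall>c\<in>B. (\<Sum>u\<in>T - {w}. l u * f' c u) = 0" by auto
    define l' where "l' = l(w := - (\<Sum>u\<in>T - {w}. l u * f b u) / f b w)"
    have split: "(\<Sum>u\<in>T. l' u * f c u) = (\<Sum>u\<in>T - {w}. l u * f' c u)" for c
    proof -
      have "(\<Sum>u\<in>T. l' u * f c u) = l' w * f c w + (\<Sum>u\<in>T - {w}. l u * f c u)"
        using insert.prems(1) w(1) by (subst sum.remove[of T w]) (auto simp: l'_def)
      also have "l' w * f c w = - (\<Sum>u\<in>T - {w}. l u * (f c w * f b u / f b w))"
        by (simp add: l'_def sum_distrib_left sum_divide_distrib mult_ac)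
      finally show ?thesis by (simp add: f'_def algebra_simps sum_subtractf)
    qed
    have "f' b u = 0" for u using w by (simp add: f'_def)
    then have "\<forall>c\<in>insert b B. (\<Sum>u\<in>T. l' u * f c u) = 0"
      using l(2) unfolding split by auto
    moreover have "\<exists>u\<in>T. l' u \<noteq> 0" using l(1) by (auto simp: l'_def)
    ultimately show ?thesis by blast
  qed
qed

section \<open>Polynomial functions filtered by degree\<close>

definition mon :: "nat \<Rightarrow> (nat \<Rightarrow> nat) \<Rightarrow> (nat \<Rightarrow> int) \<Rightarrow> real" where
  "mon m a u = (\<Prod>i<m. real_of_int (u i) ^ a i)"

text \<open>Polynomial functions in \<open>m\<close> variables of degree strictly less than \<open>k\<close>.\<close>

inductive lowdeg :: "nat \<Rightarrow> nat \<Rightarrow> ((nat \<Rightarrow> int) \<Rightarrow> real) \<Rightarrow> bool" for m k where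
  zero: "lowdeg m k (\<lambda>_. 0)"
| step: "lowdeg m k f \<Longrightarrow> (\<Sum>i<m. a i) < k \<Longrightarrow> lowdeg m k (\<lambda>u. c * mon m a u + f u)"

lemma lowdeg_mono: "lowdeg m k f \<Longrightarrow> k \<le> l \<Longrightarrow> lowdeg m l f"
  by (induction rule: lowdeg.induct) (auto intro: lowdeg.intros)

lemma lowdeg_add: "lowdeg m k f \<Longrightarrow> lowdeg m k g \<Longrightarrow> lowdeg m k (\<lambda>u. f u + g u)"
proof (induction rule: lowdeg.induct)
  case (step f a c)
  then show ?case using lowdeg.step[of m k "\<lambda>u. f u + g u" a c] by (simp add: add.assoc)
qed simp

lemma lowdeg_cmult: "lowdeg m k f \<Longrightarrow> lowdeg m k (\<lambda>u. c * f u)"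
proof (induction rule: lowdeg.induct)
  case (step f a d)
  then show ?case using lowdeg.step[of m k "\<lambda>u. c * f u" a "c * d"] by (simp add: algebra_simps)
qed (simp add: lowdeg.zero)

lemma lowdeg_diff: "lowdeg m k f \<Longrightarrow> lowdeg m k g \<Longrightarrow> lowdeg m k (\<lambda>u. f u - g u)"
  using lowdeg_add[of m k f "\<lambda>u. (- 1) * g u"] lowdeg_cmult[of m k g "- 1"] by simp

lemma lowdeg_sum: "(\<And>x. x \<in> S \<Longrightarrow> lowdeg m k (f x)) \<Longrightarrow> lowdeg m k (\<lambda>u. \<Sum>x\<in>S. f x u)"
  by (induction S rule: infinite_finite_induct) (auto intro: lowdeg_add lowdeg.zero)

lemma lowdeg_mon: "(\<Sum>i<m. a i) < k \<Longrightarrow> lowdeg m k (mon m a)"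
  using lowdeg.step[OF lowdeg.zero, where c = 1] by simp

lemma mon_add: "mon m (\<lambda>i. a i + b i) u = mon m a u * mon m b u"
  by (simp add: mon_def power_add prod.distrib)

lemma lowdeg_mon_mult: "lowdeg m l g \<Longrightarrow> lowdeg m ((\<Sum>i<m. a i) + l) (\<lambda>u. mon m a u * g u)"
proof (induction rule: lowdeg.induct)
  case (step f b c)
  then have "(\<Sum>i<m. a i + b i) < (\<Sum>i<m. a i) + l" by (simp add: sum.distrib)
  from lowdeg.step[OF step.IH this, of c] show ?case by (simp add: mon_add algebra_simps)
qed (simp add: lowdeg.zero)

text \<open>The bounds are strict: degree at most \<open>k\<close> times degree below
  \<open>l\<close> gives degree below \<open>k + l\<close>.\<close>

lemma lowdeg_mult:
  assumes "lowdeg m (Suc k) f" "lowdeg m l g"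
  shows "lowdeg m (k + l) (\<lambda>u. f u * g u)"
  using assms(1)
proof (induction rule: lowdeg.induct)
  case (step f a c)
  have "lowdeg m (k + l) (\<lambda>u. mon m a u * g u)"
    using lowdeg_mono[OF lowdeg_mon_mult[OF assms(2)]] step by simp
  from lowdeg_add[OF lowdeg_cmult[OF this, of c] step.IH] show ?case by (simp add: algebra_simps)
qed (simp add: lowdeg.zero)

lemma lowdeg_const: "lowdeg m (Suc k) (\<lambda>_. c)"
  using lowdeg_cmult[OF lowdeg_mon[where m = m and a = "\<lambda>_. 0" and k = "Suc k"], of c] by (simp add: mon_def)

lemma lowdeg_var:
  assumes "i < m"
  shows "lowdeg m (Suc (Suc k)) (\<lambda>u. real_of_int (u i))"
proof -
  let ?a = "\<lambda>j. if j = i then 1 else 0 :: nat"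
  have "mon m ?a = (\<lambda>u. real_of_int (u i))"
  proof
    fix u :: "nat \<Rightarrow> int"
    have "mon m ?a u = (\<Prod>j<m. if j = i then real_of_int (u i) else 1)"
      unfolding mon_def by (rule prod.cong) auto
    then show "mon m ?a u = real_of_int (u i)" using assms by (simp add: prod.delta)
  qed
  moreover have "(\<Sum>j<m. ?a j) = 1" using assms by (simp add: sum.delta)
  ultimately show ?thesis using lowdeg_mon[where m = m and a = ?a and k = "Suc (Suc k)"] by simp
qed

text \<open>Such products will separate one point of a finite set from all others.\<close>

lemma lowdeg_prod_linear:
  assumes "finite S" "\<And>x. x \<in> S \<Longrightarrow> i x < m"
  shows "lowdeg m (Suc (card S)) (\<lambda>u. \<Prod>x\<in>S. real_of_int (u (i x)) - c x)"
  using assms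
proof (induction S rule: finite_induct)
  case (insert x S)
  have "lowdeg m (Suc 1) (\<lambda>u. real_of_int (u (i x)) - c x)"
    using insert.prems lowdeg_var[of "i x" m 0] lowdeg_const[of m 1 "c x"] by (auto intro: lowdeg_diff)
  from lowdeg_mult[OF this insert.IH] insert show ?case by simp
qed (simp add: lowdeg_const)

text \<open>If the top degree forms of the equations defining \<open>T\<close> contain a power of every variable,
  then every function on \<open>T\<close> is a combination of the finitely many reduced monomials.\<close>

lemma card_le_of_graded_relations:
  assumes "finite T" and ext: "\<And>u i. u \<in> T \<Longrightarrow> m \<le> i \<Longrightarrow> u i = 0"
    and rel: "\<And>i. i < m \<Longrightarrow> \<exists>g. lowdeg m (N i) g \<and> (\<forall>u\<in>T. real_of_int (u i) ^ N i = g u)"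
  shows "card T \<le> (\<Prod>i<m. N i)"
proof (rule ccontr)
  define B where "B = PiE {..<m} (\<lambda>i. {..<N i})"
  assume "\<not> card T \<le> (\<Prod>i<m. N i)"
  then have "card B < card T" by (simp add: B_def card_PiE)
  moreover have "finite B" by (simp add: B_def finite_PiE)
  \<comment> \<open>There are fewer reduced monomials than points, so some nonzero functional
    \<open>L\<close> on the functions on \<open>T\<close> kills them all.\<close>
  ultimately obtain l where l: "\<exists>u\<in>T. l u \<noteq> 0" "\<forall>b\<in>B. (\<Sum>u\<in>T. l u * mon m b u) = 0"
    using exists_nontrivial_relation[of B T "mon m"] \<open>finite T\<close> by blast
  define L where "L = (\<lambda>f. \<Sum>u\<in>T. l u * f u)"
  have L_low: "L f = 0" if "lowdeg m k f" "\<And>a. (\<Sum>i<m. a i) < k \<Longrightarrow> L (mon m a) = 0" for k f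
    using that
  proof (induction rule: lowdeg.induct)
    case (step f a c)
    have "L (\<lambda>u. c * mon m a u + f u) = c * L (mon m a) + L f"
      by (simp add: L_def algebra_simps sum.distrib sum_distrib_left)
    then show ?case using step by simp
  qed (simp add: L_def)
  \<comment> \<open>If some exponent \<open>a i\<close> is at least \<open>N i\<close>, substituting
    \<open>g\<close> for the \<open>N i\<close>-th power of that variable lowers the degree on
    \<open>T\<close>.\<close>
  have L_mon: "L (mon m a) = 0" for a
  proof (induction "\<Sum>i<m. a i" arbitrary: a rule: less_induct)
    case less
    show ?case
    proof (cases "\<forall>i<m. a i < N i")
      case True
      then have "restrict a {..<m} \<in> B" by (auto simp: B_def)
      moreover have "mon m (restrict a {..<m}) = mon m a" by (auto simp: mon_def fun_eq_iff)
      ultimately show ?thesis using l(2) by (force simp: L_def)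
    next
      case False
      then obtain i where i: "i < m" "N i \<le> a i" by (auto simp: not_less)
      from rel[OF i(1)] obtain g where g: "lowdeg m (N i) g" "\<forall>u\<in>T. real_of_int (u i) ^ N i = g u"
        by blast
      define b where "b = a(i := a i - N i)"
      have "(\<Sum>j<m. a j) = (\<Sum>j<m. b j) + N i"
        using i by (simp add: b_def sum.remove[of "{..<m}" i])
      then have low: "lowdeg m (\<Sum>j<m. a j) (\<lambda>u. mon m b u * g u)"
        using lowdeg_mon_mult[OF g(1), where a = b] by simp
      have "mon m a u = mon m b u * real_of_int (u i) ^ N i" for u
      proof -
        have "mon m a u = real_of_int (u i) ^ a i * (\<Prod>j\<in>{..<m} - {i}. real_of_int (u j) ^ a j)"
          unfolding mon_def using i by (intro prod.remove) auto
        also have "real_of_int (u i) ^ a i = real_of_int (u i) ^ b i * real_of_int (u i) ^ N i"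
          using i by (simp add: b_def flip: power_add)
        also have "(\<Prod>j\<in>{..<m} - {i}. real_of_int (u j) ^ a j) = (\<Prod>j\<in>{..<m} - {i}. real_of_int (u j) ^ b j)"
          by (rule prod.cong) (auto simp: b_def)
        finally show ?thesis
          unfolding mon_def using i by (subst (2) prod.remove[of _ i]) auto
      qed
      then have "L (mon m a) = L (\<lambda>u. mon m b u * g u)" using g(2) by (simp add: L_def)
      also have "\<dots> = 0" using L_low[OF low] less by blast
      finally show ?thesis .
    qed
  qed
  obtain w where w: "w \<in> T" "l w \<noteq> 0" using l(1) by blast
  have "\<exists>i<m. w i \<noteq> v i" if "v \<in> T - {w}" for v
  proof -
    obtain i where i: "w i \<noteq> v i" using \<open>v \<in> T - {w}\<close> by (metis DiffE HOL.ext insertI1)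
    have "i < m"
    proof (rule ccontr)
      assume "\<not> i < m"
      then show False using i that w(1) ext[of w i] ext[of v i] by auto
    qed
    with i show ?thesis by blast
  qed
  then obtain idx where idx: "idx v < m" "w (idx v) \<noteq> v (idx v)" if "v \<in> T - {w}" for v
    by metis
  \<comment> \<open>\<open>d\<close> vanishes on \<open>T\<close> except at \<open>w\<close>, so
    \<open>L d\<close> is the nonzero number \<open>l w * d w\<close>, although \<open>L\<close>
    kills every polynomial function.\<close>
  define d where "d = (\<lambda>u. \<Prod>v\<in>T - {w}. real_of_int (u (idx v)) - real_of_int (v (idx v)))"
  have "lowdeg m (Suc (card (T - {w}))) d"
    unfolding d_def by (rule lowdeg_prod_linear) (use idx \<open>finite T\<close> in auto)
  then have "L d = 0" using L_low L_mon by blast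
  moreover have "d v = 0" if "v \<in> T - {w}" for v
    unfolding d_def using that \<open>finite T\<close> by (intro prod_zero) auto
  then have "L d = l w * d w"
    unfolding L_def using \<open>finite T\<close> w(1) by (subst sum.remove[of T w]) auto
  moreover have "d w \<noteq> 0" unfolding d_def using \<open>finite T\<close> idx by auto
  ultimately show False using w by simp
qed

text \<open>The functions \<open>f\<close> and \<open>g\<close> have degree at most \<open>k\<close> and the same form of degree \<open>k\<close>.\<close>

definition lead :: "nat \<Rightarrow> nat \<Rightarrow> ((nat \<Rightarrow> int) \<Rightarrow> real) \<Rightarrow> ((nat \<Rightarrow> int) \<Rightarrow> real) \<Rightarrow> bool" where
  "lead m k f g \<longleftrightarrow> lowdeg m (Suc k) f \<and> lowdeg m (Suc k) g \<and> lowdeg m k (\<lambda>u. f u - g u)"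

lemma lead_const: "lead m 0 (\<lambda>_. c) (\<lambda>_. c)"
  by (simp add: lead_def lowdeg_const lowdeg.zero)

text \<open>\<open>f f' - g g' = f (f' - g') + g' (f - g)\<close>, and each summand contains a
  factor of smaller degree.\<close>

lemma lead_mult:
  assumes "lead m k f g" "lead m l f' g'"
  shows "lead m (k + l) (\<lambda>u. f u * f' u) (\<lambda>u. g u * g' u)"
proof -
  have "lowdeg m (k + l) (\<lambda>u. f u * (f' u - g' u))"
    using assms by (auto simp: lead_def intro: lowdeg_mult)
  moreover have "lowdeg m (l + k) (\<lambda>u. g' u * (f u - g u))"
    using assms by (auto simp: lead_def intro: lowdeg_mult)
  ultimately have "lowdeg m (k + l) (\<lambda>u. f u * f' u - g u * g' u)"
    using lowdeg_add[of m "k + l" "\<lambda>u. f u * (f' u - g' u)" "\<lambda>u. g' u * (f u - g u)"]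
    by (simp add: algebra_simps)
  moreover have "lowdeg m (k + Suc l) (\<lambda>u. f u * f' u)" "lowdeg m (k + Suc l) (\<lambda>u. g u * g' u)"
    using assms unfolding lead_def by (blast intro: lowdeg_mult)+
  ultimately show ?thesis by (simp add: lead_def)
qed

lemma lead_sum:
  assumes "\<And>x. x \<in> S \<Longrightarrow> lead m k (f x) (g x)"
  shows "lead m k (\<lambda>u. \<Sum>x\<in>S. f x u) (\<lambda>u. \<Sum>x\<in>S. g x u)"
  using assms by (simp add: lead_def lowdeg_sum flip: sum_subtractf)

lemma lead_prod:
  assumes "\<And>x. x \<in> S \<Longrightarrow> lead m (e x) (f x) (g x)"
  shows "lead m (\<Sum>x\<in>S. e x) (\<lambda>u. \<Prod>x\<in>S. f x u) (\<lambda>u. \<Prod>x\<in>S. g x u)"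
  using assms by (induction S rule: infinite_finite_induct) (auto intro: lead_mult lead_const)

text \<open>The degree \<open>e j\<close> depends on the column only, so all permutation terms share
  one total degree.\<close>

lemma lead_det:
  assumes "\<And>i j. i < n \<Longrightarrow> j < n \<Longrightarrow> lead m (e j) (F i j) (G i j)"
  shows "lead m (\<Sum>j<n. e j) (\<lambda>u. det (mat n n (\<lambda>(i, j). F i j u))) (\<lambda>u. det (mat n n (\<lambda>(i, j). G i j u)))"
proof -
  let ?P = "{p. p permutes {0..<n}}"
  have lead_perm: "lead m (\<Sum>j<n. e j) (\<lambda>u. signof p * (\<Prod>i = 0..<n. F i (p i) u))
      (\<lambda>u. signof p * (\<Prod>i = 0..<n. G i (p i) u))" if "p \<in> ?P" for p
  proof -
    have p: "p permutes {0..<n}" using that by simp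
    have "lead m (\<Sum>i = 0..<n. e (p i)) (\<lambda>u. \<Prod>i = 0..<n. F i (p i) u) (\<lambda>u. \<Prod>i = 0..<n. G i (p i) u)"
      using p by (intro lead_prod assms) (auto simp: permutes_in_image)
    moreover have "(\<Sum>i = 0..<n. e (p i)) = (\<Sum>j<n. e j)"
      using sum.permute[OF p, of e] by (simp add: comp_def lessThan_atLeast0)
    ultimately show ?thesis using lead_mult[OF lead_const[of m "signof p"]] by fastforce
  qed
  have "det (mat n n (\<lambda>(i, j). F i j u)) = (\<Sum>p\<in>?P. signof p * (\<Prod>i = 0..<n. F i (p i) u))"
    for F :: "nat \<Rightarrow> nat \<Rightarrow> (nat \<Rightarrow> int) \<Rightarrow> real" and u
    by (subst det_def'[of _ n])
      (auto intro!: sum.cong prod.cong simp: permutes_in_image[of _ "{0..<n}", simplified])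
  then show ?thesis using lead_sum[OF lead_perm, of ?P "\<lambda>p. p"] by simp
qed

lemma lead_kry:
  assumes "\<And>i j. i < n \<Longrightarrow> j < n \<Longrightarrow> lead m 1 (a i j) (b i j)" "i < n"
  shows "lead m j (\<lambda>u. kry n (\<lambda>i j. a i j u) j i) (\<lambda>u. kry n (\<lambda>i j. b i j u) j i)"
  using assms(2)
proof (induction j arbitrary: i)
  case 0
  then show ?case using lead_const[of m "if i = 0 then 1 else 0"] by simp
next
  case (Suc j)
  have "lead m (1 + j) (\<lambda>u. a i k u * kry n (\<lambda>i j. a i j u) j k)
      (\<lambda>u. b i k u * kry n (\<lambda>i j. b i j u) j k)" if "k < n" for k
    using that Suc by (intro lead_mult assms) auto
  then show ?case
    using lead_sum[of "{..<n}" m "1 + j" "\<lambda>k u. a i k u * kry n (\<lambda>i j. a i j u) j k"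
        "\<lambda>k u. b i k u * kry n (\<lambda>i j. b i j u) j k"] by simp
qed

lemma lowdeg_var_power: "i < m \<Longrightarrow> lowdeg m (Suc k) (\<lambda>u. real_of_int (u i) ^ k)"
proof (induction k)
  case (Suc k)
  from lowdeg_mult[OF lowdeg_var[OF Suc.prems, of 0] Suc.IH[OF Suc.prems]] show ?case by simp
qed (simp add: lowdeg_const)

lemma poly_char_poly_eq_det:
  fixes A :: "'a::comm_ring_1 mat"
  assumes "A \<in> carrier_mat n n"
  shows "poly (char_poly A) t = det (mat n n (\<lambda>(i, j). (if i = j then t else 0) - A $$ (i, j)))"
  unfolding char_poly_def
  by (rule poly_det_cong[of _ n]) (use assms in \<open>auto simp: char_poly_matrix_index[OF assms]\<close>)

text \<open>These matrices form the space \<open>U\<close>, with \<open>u n\<close> the common entry of the subdiagonal.\<close>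

definition shift :: "nat \<Rightarrow> (nat \<Rightarrow> int) \<Rightarrow> nat \<Rightarrow> nat \<Rightarrow> int" where
  "shift n u i j = (if i = j then u i else if i = Suc j then u n else 0)"

text \<open>A lower bidiagonal matrix extends the support of a vector by at most one position, and
  the new entry gains a factor \<open>u n\<close>. So the Krylov matrix is upper triangular.\<close>

lemma kry_shift:
  assumes "i < n"
  shows "j < i \<Longrightarrow> kry n (shift n u) j i = 0" "kry n (shift n u) i i = u n ^ i"
proof -
  have zero: "kry n (shift n u) j i = 0" if "j < i" for i j
    using that
  proof (induction j arbitrary: i)
    case (Suc j)
    have "shift n u i k * kry n (shift n u) j k = 0" for k
    proof (cases "j < k")
      case False
      then show ?thesis using Suc.prems by (simp add: shift_def)
    qed (simp add: Suc.IH)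
    then show ?case by (simp del: mult_eq_0_iff)
  qed simp
  show "j < i \<Longrightarrow> kry n (shift n u) j i = 0" by (rule zero)
  show "kry n (shift n u) i i = u n ^ i"
    using assms
  proof (induction i)
    case (Suc i)
    have "shift n u (Suc i) k * kry n (shift n u) i k = (if k = i then u n * u n ^ i else 0)" for k
    proof (cases "i < k")
      case False
      have "kry n (shift n u) i i = u n ^ i" using Suc by simp
      then show ?thesis using False by (auto simp: shift_def[of n u "Suc i"])
    qed (simp add: zero)
    then show ?case using Suc.prems by (simp add: sum.delta)
  qed simp
qed

lemma kdet_shift: "kdet n (shift n u) = u n ^ (\<Sum>j<n. j)"
proof -
  have "upper_triangular (kmat n (shift n u))"
    using kry_shift(1) by (auto simp: upper_triangular_def kmat_def)
  then have "kdet n (shift n u) = prod_list (diag_mat (kmat n (shift n u)))"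
    unfolding kdet_def by (rule det_upper_triangular[OF _ kmat_carrier])
  also have "\<dots> = (\<Prod>j<n. u n ^ j)"
    by (auto simp: prod_list_diag_prod kmat_def lessThan_atLeast0 kry_shift intro!: prod.cong)
  finally show ?thesis by (simp add: power_sum)
qed

lemma lead_shift:
  assumes "i < n" "j < n"
  shows "lead (Suc n) 1 (\<lambda>u. real_of_int (a + shift n u i j)) (\<lambda>u. real_of_int (shift n u i j))"
proof -
  have s: "lowdeg (Suc n) 2 (\<lambda>u. real_of_int (shift n u i j))"
    using assms lowdeg_var[of i "Suc n" 0] lowdeg_var[of n "Suc n" 0] lowdeg.zero[of "Suc n" 2]
    by (cases "i = j"; cases "i = Suc j") (simp_all add: shift_def numeral_2_eq_2)
  show ?thesis
    using lowdeg_add[OF lowdeg_const[of "Suc n" 1 "real_of_int a"]] s lowdeg_const[of "Suc n" 0]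
    by (auto simp: lead_def numeral_2_eq_2)
qed

text \<open>The bound is uniform in \<open>f\<close> and \<open>a\<close>, since both enter only as
  constants and only degrees in \<open>u\<close> matter. Its factors are the exponents
  \<open>N i\<close> of the pure powers in the top forms.\<close>

lemma card_shift_fiber_le:
  fixes a :: "nat \<Rightarrow> nat \<Rightarrow> int" and f :: "int poly" and n :: nat
  defines "b \<equiv> \<lambda>u i j. a i j + shift n u i j"
  assumes f: "monic f" "degree f = n" and "finite T" and ext: "\<And>u i. u \<in> T \<Longrightarrow> n < i \<Longrightarrow> u i = 0"
    and char: "\<And>u. u \<in> T \<Longrightarrow> char_poly (mat n n (\<lambda>(i, j). b u i j)) = f"
    and kdet0: "\<And>u. u \<in> T \<Longrightarrow> kdet n (b u) = 0"
  shows "card T \<le> n ^ n * (\<Sum>j<n. j)"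
proof -
  let ?m = "Suc n"
  define N where "N = (\<lambda>i. if i < n then n else \<Sum>j<n. j)"
  have "card T \<le> (\<Prod>i<?m. N i)"
  proof (rule card_le_of_graded_relations[OF \<open>finite T\<close>])
    show "u i = 0" if "u \<in> T" "?m \<le> i" for u i using ext that by auto
    show "\<exists>g. lowdeg ?m (N i) g \<and> (\<forall>u\<in>T. real_of_int (u i) ^ N i = g u)" if "i < ?m" for i
    proof (cases "i < n")
      case True
      define D where "D = (\<lambda>c u. det (mat n n (\<lambda>(k, l). (if k = l then real_of_int (u i) else 0)
          - real_of_int (c u k l))))"
      define g where "g = (\<lambda>u. D b u - (\<Sum>k<n. real_of_int (coeff f k) * real_of_int (u i) ^ k))"
      have D: "lead ?m (\<Sum>j<n. 1) (D b) (D (shift n))"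
        unfolding D_def
      proof (rule lead_det)
        fix k l assume kl: "k < n" "l < n"
        have d: "lowdeg ?m 2 (\<lambda>u. if k = l then real_of_int (u i) else 0)"
          using True lowdeg_var[of i ?m 0] lowdeg.zero[of ?m 2]
          by (cases "k = l") (simp_all add: numeral_2_eq_2)
        have "lowdeg ?m 2 (\<lambda>u. real_of_int (b u k l))" "lowdeg ?m 2 (\<lambda>u. real_of_int (shift n u k l))"
          using lead_shift[OF kl, of "a k l"] by (auto simp: b_def lead_def numeral_2_eq_2)
        with lowdeg_const[of ?m 0 "- real_of_int (a k l)"] d
        show "lead ?m 1 (\<lambda>u. (if k = l then real_of_int (u i) else 0) - real_of_int (b u k l))
            (\<lambda>u. (if k = l then real_of_int (u i) else 0) - real_of_int (shift n u k l))"
          by (auto simp: lead_def numeral_2_eq_2 b_def intro!: lowdeg_diff)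
      qed
      \<comment> \<open>The top form is the product of \<open>u i - u k\<close> over
        \<open>k < n\<close>, whose factor \<open>k = i\<close> vanishes. So \<open>D b\<close> has
        degree below \<open>n\<close>, while on \<open>T\<close> it equals \<open>f\<close> at
        \<open>u i\<close>, with leading term the \<open>n\<close>-th power of
        \<open>u i\<close>.\<close>
      have "D (shift n) u = 0" for u
      proof -
        let ?M = "mat n n (\<lambda>(k, l). (if k = l then real_of_int (u i) else 0) - real_of_int (shift n u k l))"
        have "D (shift n) u = prod_list (diag_mat ?M)"
          unfolding D_def by (rule det_lower_triangular[of n]) (auto simp: shift_def)
        also have "\<dots> = 0"
          unfolding prod_list_diag_prod using True by (intro prod_zero) (auto simp: shift_def intro!: bexI[of _ i])
        finally show ?thesis .
      qed
      then have "lowdeg ?m n (D b)" using D by (simp add: lead_def)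
      moreover have "lowdeg ?m n (\<lambda>u. \<Sum>k<n. real_of_int (coeff f k) * real_of_int (u i) ^ k)"
        using True by (intro lowdeg_sum lowdeg_cmult lowdeg_mono[OF lowdeg_var_power]) auto
      ultimately have "lowdeg ?m n g" unfolding g_def by (rule lowdeg_diff)
      moreover have "real_of_int (u i) ^ n = g u" if "u \<in> T" for u
      proof -
        let ?M = "mat n n (\<lambda>(k, l). (if k = l then u i else 0) - b u k l)"
        have "poly f (u i) = det ?M"
          using poly_char_poly_eq_det[of "mat n n (\<lambda>(i, j). b u i j)" n "u i"] char[OF that]
          by (auto intro!: arg_cong[where f = det])
        moreover have "real_of_int (det ?M) = D b u"
        proof -
          have "real_of_int (det ?M) = det (map_mat real_of_int ?M)" by simp
          also have "map_mat real_of_int ?M = mat n n (\<lambda>(k, l). (if k = l then real_of_int (u i) else 0)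
              - real_of_int (b u k l))" by (rule eq_matI) auto
          finally show ?thesis by (simp add: D_def)
        qed
        moreover have "poly f (u i) = u i ^ n + (\<Sum>k<n. coeff f k * u i ^ k)"
          using f by (simp add: poly_altdef lessThan_Suc_atMost[symmetric])
        ultimately show ?thesis unfolding g_def
          by (metis (no_types, lifting) add_diff_cancel_right' of_int_add of_int_mult of_int_power of_int_sum sum.cong)
      qed
      ultimately show ?thesis using True by (auto simp: N_def)
    next
      case False
      then have "i = n" using that by simp
      \<comment> \<open>For the subdiagonal variable the relation is the vanishing of the Krylov
        determinant, whose top form is a power of \<open>u n\<close>.\<close>
      define K where "K = (\<lambda>c (u :: nat \<Rightarrow> int). kdet n (\<lambda>k l. real_of_int (c u k l)))"
      have K: "K c u = real_of_int (kdet n (c u))" for c u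
        by (simp add: K_def of_int_hom.hom_kdet)
      have "lead ?m (\<Sum>j<n. j) (K b) (K (shift n))"
        unfolding K_def kdet_def kmat_def b_def by (intro lead_det lead_kry lead_shift)
      then have "lowdeg ?m (\<Sum>j<n. j) (\<lambda>u. K b u - real_of_int (u n) ^ (\<Sum>j<n. j))"
        by (simp add: lead_def K kdet_shift)
      from lowdeg_cmult[OF this, of "- 1"]
      have "lowdeg ?m (N i) (\<lambda>u. real_of_int (u i) ^ N i - K b u)" by (simp add: N_def \<open>i = n\<close>)
      then show ?thesis using kdet0 by (intro exI[of _ "\<lambda>u. real_of_int (u i) ^ N i - K b u"]) (auto simp: K)
    qed
  qed
  then show ?thesis by (simp add: N_def)
qed

section \<open>Level sets and size of the Krylov determinant\<close>

lemma card_le_of_fibers: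
  assumes "finite A" "finite B" "\<And>a. a \<in> A \<Longrightarrow> g a \<in> B" "\<And>b. b \<in> B \<Longrightarrow> card {a \<in> A. g a = b} \<le> k"
  shows "card A \<le> card B * k"
proof -
  have "A \<subseteq> (\<Union>b\<in>B. {a \<in> A. g a = b})" using assms(3) by auto
  then have "card A \<le> card (\<Union>b\<in>B. {a \<in> A. g a = b})"
    using assms(1,2) by (intro card_mono) auto
  also have "\<dots> \<le> (\<Sum>b\<in>B. card {a \<in> A. g a = b})" by (rule card_UN_le[OF assms(2)])
  also have "\<dots> \<le> (\<Sum>b\<in>B. k)" by (rule sum_mono) (rule assms(4))
  finally show ?thesis by simp
qed

text \<open>Replacing the coordinates of \<open>0\<close> one after the other by those of a solution \<open>c\<close>, at some step \<open>i\<close>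
  the value becomes \<open>D\<close>; then \<open>c i\<close> is a root of a nonzero polynomial determined by the
  coordinates before \<open>i\<close>.\<close>

lemma card_level_set_le:
  fixes F :: "(nat \<Rightarrow> int) \<Rightarrow> int" and B :: "int set"
  assumes "finite B" and F0: "F (\<lambda>_. 0) \<noteq> D"
    and pol: "\<And>c i. i < m \<Longrightarrow> \<exists>p. degree p \<le> d \<and> (\<forall>t. F (c(i := t)) = poly p t)"
  shows "card {c \<in> PiE {..<m} (\<lambda>_. B). F (\<lambda>i. if i < m then c i else 0) = D} \<le> m * (card B ^ (m - 1) * d)"
proof -
  define T where "T = (\<lambda>c k (i::nat). if i < k then c i else 0 :: int)"
  define S where "S = (\<lambda>i. {c \<in> PiE {..<m} (\<lambda>_. B). F (T c i) \<noteq> D \<and> F ((T c i)(i := c i)) = D})"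
  have fin: "finite (PiE {..<m} (\<lambda>_. B))" using \<open>finite B\<close> by (intro finite_PiE) auto
  have finS: "finite (S i)" for i using fin by (rule rev_finite_subset) (auto simp: S_def)
  have T_Suc: "T c (Suc i) = (T c i)(i := c i)" for c i by (auto simp: T_def fun_eq_iff)
  have "{c \<in> PiE {..<m} (\<lambda>_. B). F (T c m) = D} \<subseteq> (\<Union>i<m. S i)"
  proof
    fix c assume c: "c \<in> {c \<in> PiE {..<m} (\<lambda>_. B). F (T c m) = D}"
    define k where "k = (LEAST k. F (T c k) = D)"
    have k: "F (T c k) = D" "k \<le> m" unfolding k_def using c LeastI[of "\<lambda>k. F (T c k) = D" m] Least_le[of "\<lambda>k. F (T c k) = D" m] by simp_all
    have "k \<noteq> 0"
    proof
      assume "k = 0"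
      then show False using k(1) F0 by (simp add: T_def)
    qed
    then obtain i where i: "k = Suc i" by (cases k) auto
    then have "F (T c i) \<noteq> D"
      using not_less_Least[of i "\<lambda>k. F (T c k) = D"] by (simp flip: k_def)
    then show "c \<in> (\<Union>i<m. S i)" using i k c by (auto simp: S_def T_Suc)
  qed
  then have "card {c \<in> PiE {..<m} (\<lambda>_. B). F (T c m) = D} \<le> card (\<Union>i<m. S i)"
    using finS by (intro card_mono) auto
  also have "\<dots> \<le> (\<Sum>i<m. card (S i))" by (rule card_UN_le) simp
  also have "\<dots> \<le> (\<Sum>i<m. card B ^ (m - 1) * d)"
  proof (rule sum_mono)
    fix i assume "i \<in> {..<m}"
    then have im: "i < m" by simp
    \<comment> \<open>Fixing all coordinates except \<open>i\<close> determines \<open>T c i\<close>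
      and leaves only \<open>c i\<close> free.\<close>
    let ?R = "\<lambda>c. restrict c ({..<m} - {i})" and ?B = "PiE ({..<m} - {i}) (\<lambda>_. B)"
    have "card (S i) \<le> card ?B * d"
    proof (rule card_le_of_fibers[OF finS, where g = ?R])
      show "finite ?B" using \<open>finite B\<close> by (intro finite_PiE) auto
      show "?R c \<in> ?B" if "c \<in> S i" for c using that by (auto simp: S_def)
      fix r
      let ?A = "{c \<in> S i. ?R c = r}"
      show "card ?A \<le> d"
      proof (cases "?A = {}")
        case False
        then obtain c0 where c0: "c0 \<in> S i" "?R c0 = r" by blast
        obtain p where p: "degree p \<le> d" "\<And>t. F ((T c0 i)(i := t)) = poly p t"
          using pol[OF im, of "T c0 i"] by blast
        have eq: "c j = c0 j" if "c \<in> ?A" "j < m" "j \<noteq> i" for c j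
        proof -
          have "?R c j = ?R c0 j" using that(1) c0(2) by simp
          then show ?thesis using that by (simp only: restrict_apply) simp
        qed
        have Teq: "T c i = T c0 i" if "c \<in> ?A" for c
          using eq[OF that] im by (auto simp: T_def fun_eq_iff)
        define q where "q = p - [:D:]"
        \<comment> \<open>Coordinate \<open>i\<close> of \<open>T c0 i\<close> is already
          \<open>0\<close>, so \<open>poly q 0\<close> is the value before the step minus
          \<open>D\<close>, which is nonzero.\<close>
        have "(T c0 i)(i := 0) = T c0 i" by (auto simp: T_def)
        then have "poly q 0 \<noteq> 0" using c0(1) p(2)[of 0] by (simp add: q_def S_def)
        then have "q \<noteq> 0" by auto
        have "(\<lambda>c. c i) ` ?A \<subseteq> {t. poly q t = 0}"
        proof
          fix t assume "t \<in> (\<lambda>c. c i) ` ?A"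
          then obtain c where c: "c \<in> ?A" "t = c i" by blast
          then have "F ((T c i)(i := c i)) = D" by (simp add: S_def)
          then show "t \<in> {t. poly q t = 0}" using Teq[OF c(1)] c(2) p(2) by (simp add: q_def)
        qed
        moreover have "inj_on (\<lambda>c. c i) ?A"
        proof (rule inj_onI)
          fix c c' assume *: "c \<in> ?A" "c' \<in> ?A" "c i = c' i"
          then have "c \<in> PiE {..<m} (\<lambda>_. B)" "c' \<in> PiE {..<m} (\<lambda>_. B)" by (auto simp: S_def)
          then show "c = c'"
          proof (rule PiE_ext)
            fix j assume "j \<in> {..<m}"
            then show "c j = c' j" using eq[OF *(1)] eq[OF *(2)] *(3) by (cases "j = i") auto
          qed
        qed
        moreover have "finite {t. poly q t = 0}" using \<open>q \<noteq> 0\<close> by (rule poly_roots_finite)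
        ultimately have "card ?A \<le> card {t. poly q t = 0}"
          using card_inj_on_le by blast
        also have "\<dots> \<le> degree q" using \<open>q \<noteq> 0\<close> by (rule poly_roots_degree)
        also have "\<dots> \<le> d" unfolding q_def using p(1) by (intro degree_diff_le) auto
        finally show ?thesis .
      next
        case True
        show ?thesis unfolding True by simp
      qed
    qed
    also have "card ?B = card B ^ (m - 1)" using im by (simp add: card_PiE)
    finally show "card (S i) \<le> card B ^ (m - 1) * d" .
  qed
  finally show ?thesis by (simp add: T_def)
qed

lemma degree_kry_le:
  assumes "\<And>i j. degree (a i j) \<le> 1"
  shows "degree (kry n a j i) \<le> j"
proof (induction j arbitrary: i)
  case (Suc j)
  have "degree (a i k * kry n a j k) \<le> Suc j" for k
    using degree_mult_le[of "a i k" "kry n a j k"] assms[of i k] Suc[of k] by simp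
  then show ?case unfolding kry.simps by (intro degree_sum_le) auto
qed simp

lemma degree_kdet_le:
  assumes "\<And>i j. degree (a i j) \<le> 1"
  shows "degree (kdet n a) \<le> n * n"
  unfolding kdet_def
proof (rule degree_det_le[OF _ kmat_carrier])
  fix i j assume "i < n" "j < n"
  then show "degree (kmat n a $$ (i, j)) \<le> n"
    using degree_kry_le[of a n j i] assms by (simp add: kmat_def)
qed

text \<open>Row \<open>0\<close> may be set to zero by \<open>kdet_zero_row\<close>. The index is
  shifted because columns are encoded as functions on \<open>{..<n - 1}\<close>.\<close>

definition column_mat :: "(nat \<Rightarrow> nat \<Rightarrow> 'a) \<Rightarrow> (nat \<Rightarrow> 'a) \<Rightarrow> nat \<Rightarrow> nat \<Rightarrow> 'a::zero" where
  "column_mat M c i j = (if i = 0 then 0 else if j = 0 then c (i - 1) else M i j)"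

lemma card_kdet_level_set_le:
  assumes "2 \<le> n" "D \<noteq> 0" "finite B"
  shows "card {c \<in> PiE {..<n - 1} (\<lambda>_. B). kdet n (column_mat M (\<lambda>i. if i < n - 1 then c i else 0)) = (D::int)}
     \<le> (n - 1) * (card B ^ (n - 2) * (n * n))"
proof -
  have "card {c \<in> PiE {..<n - 1} (\<lambda>_. B). kdet n (column_mat M (\<lambda>i. if i < n - 1 then c i else 0)) = D}
     \<le> (n - 1) * (card B ^ (n - 1 - 1) * (n * n))"
  proof (rule card_level_set_le[OF \<open>finite B\<close>])
    have "kdet n (column_mat M (\<lambda>_. 0)) = 0"
      using assms(1) by (intro kdet_zero_column) (auto simp: column_mat_def)
    then show "kdet n (column_mat M (\<lambda>_. 0)) \<noteq> D" using assms(2) by simp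
    fix c :: "nat \<Rightarrow> int" and i
    \<comment> \<open>Coordinate \<open>i\<close> becomes the indeterminate; evaluation at
      \<open>t\<close> is a ring homomorphism and commutes with \<open>kdet\<close>.\<close>
    define P where "P = column_mat (\<lambda>i j. [:M i j:]) (\<lambda>j. if j = i then [:0, 1:] else [:c j:])"
    have "poly (kdet n P) t = kdet n (column_mat M (c(i := t)))" for t
    proof -
      have ev: "comm_ring_hom (\<lambda>p::int poly. poly p t)" by unfold_locales auto
      have "(\<lambda>k l. poly (P k l) t) = column_mat M (c(i := t))"
        by (auto simp: P_def column_mat_def fun_eq_iff)
      then show ?thesis using comm_ring_hom.hom_kdet[OF ev, of n P] by simp
    qed
    moreover have "degree (kdet n P) \<le> n * n"
      by (rule degree_kdet_le) (auto simp: P_def column_mat_def)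
    ultimately show "\<exists>p. degree p \<le> n * n \<and> (\<forall>t. kdet n (column_mat M (c(i := t))) = poly p t)" by metis
  qed
  moreover have "n - 1 - 1 = n - 2" by simp
  ultimately show ?thesis by metis
qed

lemma abs_kry_le:
  fixes a :: "nat \<Rightarrow> nat \<Rightarrow> int"
  assumes "\<And>i j. i < n \<Longrightarrow> j < n \<Longrightarrow> \<bar>a i j\<bar> \<le> h" "i < n"
  shows "\<bar>kry n a j i\<bar> \<le> (int n * h) ^ j"
  using assms(2)
proof (induction j arbitrary: i)
  case (Suc j)
  have "0 \<le> h" using assms(1)[of i i] Suc.prems by linarith
  have "\<bar>kry n a (Suc j) i\<bar> \<le> (\<Sum>k<n. \<bar>a i k * kry n a j k\<bar>)" by (simp add: sum_abs)
  also have "\<dots> \<le> (\<Sum>k<n. h * (int n * h) ^ j)"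
    using Suc assms(1) \<open>0 \<le> h\<close> by (intro sum_mono) (auto simp: abs_mult intro!: mult_mono)
  finally show ?case by simp
qed auto

text \<open>Any bound polynomial in \<open>h\<close> suffices, since the divisor bound turns it into
  an arbitrarily small power of \<open>H\<close>.\<close>

lemma abs_kdet_le:
  fixes a :: "nat \<Rightarrow> nat \<Rightarrow> int"
  assumes "\<And>i j. i < n \<Longrightarrow> j < n \<Longrightarrow> \<bar>a i j\<bar> \<le> h" "1 \<le> h" "1 \<le> n"
  shows "\<bar>kdet n a\<bar> \<le> fact n * (int n * h) ^ (n * n)"
proof -
  let ?P = "{p. p permutes {0..<n}}" and ?b = "int n * h"
  have b: "1 \<le> ?b" using mult_mono[of 1 "int n" 1 h] assms(2,3) by simp
  have "\<bar>kdet n a\<bar> \<le> (\<Sum>p\<in>?P. \<bar>signof p * (\<Prod>i = 0..<n. kmat n a $$ (i, p i))\<bar>)"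
    unfolding kdet_def by (subst det_def'[OF kmat_carrier]) (rule sum_abs)
  also have "\<dots> \<le> (\<Sum>p\<in>?P. ?b ^ (n * n))"
  proof (rule sum_mono)
    fix p assume "p \<in> ?P"
    then have p: "p i < n" if "i < n" for i using that permutes_in_image[of p "{0..<n}" i] by auto
    have "\<bar>signof p * (\<Prod>i = 0..<n. kmat n a $$ (i, p i))\<bar> = (\<Prod>i = 0..<n. \<bar>kry n a (p i) i\<bar>)"
      using p by (simp add: abs_mult abs_prod kmat_def sign_def)
    also have "\<dots> \<le> (\<Prod>i = 0..<n. ?b ^ n)"
    proof (rule prod_mono)
      fix i assume "i \<in> {0..<n}"
      then have "\<bar>kry n a (p i) i\<bar> \<le> ?b ^ p i" using abs_kry_le[OF assms(1)] by auto
      also have "\<dots> \<le> ?b ^ n" using p[of i] \<open>i \<in> {0..<n}\<close> b by (intro power_increasing) auto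
      finally show "0 \<le> \<bar>kry n a (p i) i\<bar> \<and> \<bar>kry n a (p i) i\<bar> \<le> ?b ^ n" by simp
    qed
    finally show "\<bar>signof p * (\<Prod>i = 0..<n. kmat n a $$ (i, p i))\<bar> \<le> ?b ^ (n * n)"
      by (simp add: power_mult)
  qed
  also have "\<dots> = fact n * ?b ^ (n * n)" by (simp add: card_permutations[of _ n])
  finally show ?thesis .
qed

section \<open>The divisor bound\<close>

lemma multiplicity_factor_bound:
  assumes "0 < (e::real)"
  shows "\<exists>C\<ge>1. \<forall>k. real (Suc k) \<le> C * 2 powr (e * real k)"
proof -
  \<comment> \<open>The estimate is \<open>1 + x <= exp x\<close> at
    \<open>x = e * k * ln 2\<close>; the summand \<open>1 / (e * ln 2)\<close> turns
    \<open>x\<close> into \<open>k\<close>.\<close>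
  define C where "C = 1 + 1 / (e * ln 2)"
  have pos: "0 < e * ln 2" using assms by simp
  have "real (Suc k) \<le> C * 2 powr (e * real k)" for k
  proof -
    have "1 + e * real k * ln 2 \<le> 2 powr (e * real k)"
      by (simp add: powr_def mult_ac)
    then have "C * (1 + e * real k * ln 2) \<le> C * 2 powr (e * real k)"
      using pos by (intro mult_left_mono) (auto simp: C_def)
    moreover have "C * (1 + e * real k * ln 2) = 1 + e * real k * ln 2 + 1 / (e * ln 2) + real k"
      using pos assms by (simp add: C_def field_simps)
    moreover have "0 \<le> e * real k * ln 2" "0 \<le> 1 / (e * ln 2)" using assms by simp_all
    ultimately show ?thesis by linarith
  qed
  moreover have "1 \<le> C" using pos by (simp add: C_def)
  ultimately show ?thesis by blast
qed

lemma card_divisors_prime_power_mult: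
  fixes p :: nat
  assumes "prime p" "0 < m"
  shows "card {d. d dvd p ^ k * m} \<le> Suc k * card {d. d dvd m}"
proof -
  have fin: "finite {d. d dvd m}" using assms by (simp add: finite_divisors_nat)
  have "{d. d dvd p ^ k * m} \<subseteq> (\<lambda>(i, d). p ^ i * d) ` ({..k} \<times> {d. d dvd m})"
  proof
    fix d assume "d \<in> {d. d dvd p ^ k * m}"
    then have "d dvd p ^ k * m" by simp
    then obtain x y where "d = x * y" "x dvd p ^ k" "y dvd m" by (metis division_decomp)
    moreover from this obtain i where "i \<le> k" "x = p ^ i"
      using assms(1) by (auto simp: divides_primepow_nat)
    ultimately show "d \<in> (\<lambda>(i, d). p ^ i * d) ` ({..k} \<times> {d. d dvd m})" by auto
  qed
  then have "card {d. d dvd p ^ k * m} \<le> card ((\<lambda>(i, d). p ^ i * d) ` ({..k} \<times> {d. d dvd m}))"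
    using fin by (intro card_mono) auto
  also have "\<dots> \<le> card ({..k} \<times> {d. d dvd m})" using fin by (intro card_image_le) auto
  finally show ?thesis by (simp add: card_cartesian_product)
qed

text \<open>A prime \<open>p\<close> with \<open>p powr e \<ge> 2\<close> satisfies \<open>k + 1 \<le> p powr (e * k)\<close>, so only the boundedly
  many smaller primes contribute to the constant.\<close>

lemma divisor_bound:
  assumes "0 < (e::real)"
  shows "\<exists>C>0. \<forall>n>0. real (card {d::nat. d dvd n}) \<le> C * real n powr e"
proof -
  obtain C where C: "1 \<le> C" "\<And>k. real (Suc k) \<le> C * 2 powr (e * real k)"
    using multiplicity_factor_bound[OF assms] by blast
  define B where "B = 2 powr (1 / e)"
  define S where "S = (\<lambda>n. {p::nat. prime p \<and> p dvd n \<and> real p < B})"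
  have finS: "finite {p::nat. real p < B}"
    by (rule finite_subset[of _ "{..nat \<lceil>B\<rceil>}"]) (auto simp: le_nat_iff, linarith)
  have S_fin: "finite (S n)" for n by (rule finite_subset[OF _ finS]) (auto simp: S_def)
  \<comment> \<open>Strong induction splits off the full power of one prime. A prime below
    \<open>B\<close> costs a factor \<open>C\<close>, a larger one nothing.\<close>
  have main: "real (card {d. d dvd n}) \<le> C ^ card (S n) * real n powr e" if "0 < n" for n
    using that
  proof (induction n rule: less_induct)
    case (less n)
    show ?case
    proof (cases "n = 1")
      case True
      then show ?thesis using C(1) by (simp add: S_def)
    next
      case False
      then obtain p where p: "prime p" "p dvd n" using prime_factor_nat by blast
      define k where "k = multiplicity p n"
      obtain m where m: "n = p ^ k * m" "\<not> p dvd m"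
        using multiplicity_decompose'[of n p] less.prems p(1) unfolding k_def
        by (metis not_prime_unit less_numeral_extra(3))
      have "0 < m" using m less.prems by (cases m) auto
      have "0 < k" using m p less.prems by (cases k) auto
      have p2: "2 \<le> p" using p(1) by (rule prime_ge_2_nat)
      have "m < n"
      proof -
        have "1 < p ^ k" using p2 \<open>0 < k\<close> by (intro one_less_power) auto
        then show ?thesis using m(1) \<open>0 < m\<close> by simp
      qed
      have IH: "real (card {d. d dvd m}) \<le> C ^ card (S m) * real m powr e"
        using less.IH[OF \<open>m < n\<close> \<open>0 < m\<close>] .
      have sub: "S m \<subseteq> S n" using m by (auto simp: S_def)
      have pk: "real (p ^ k) powr e = (real p powr e) powr real k"
        using p2 by (simp add: powr_powr powr_realpow[symmetric] mult.commute)
      have "real (Suc k) * C ^ card (S m) \<le> C ^ card (S n) * real (p ^ k) powr e"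
      proof (cases "real p < B")
        case True
        then have "p \<in> S n" "p \<notin> S m" using p m by (auto simp: S_def)
        then have "card (S m) < card (S n)"
          using sub S_fin by (intro psubset_card_mono) auto
        then have "C ^ Suc (card (S m)) \<le> C ^ card (S n)"
          using C(1) by (intro power_increasing) auto
        moreover have "real (Suc k) \<le> C * real (p ^ k) powr e"
        proof -
          have "2 powr (e * real k) \<le> real p powr (e * real k)"
            using p2 assms by (intro powr_mono2) auto
          then have "C * 2 powr (e * real k) \<le> C * real (p ^ k) powr e"
            unfolding pk using C(1) by (simp add: powr_powr)
          then show ?thesis using C(2)[of k] by linarith
        qed
        ultimately have "C ^ card (S m) * real (Suc k) \<le> C ^ card (S m) * (C * real (p ^ k) powr e)"
          "C ^ Suc (card (S m)) * real (p ^ k) powr e \<le> C ^ card (S n) * real (p ^ k) powr e"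
          using C(1) by (intro mult_left_mono mult_right_mono; simp)+
        then show ?thesis by (simp add: mult_ac)
      next
        case False
        have "2 = B powr e" using assms by (simp add: B_def powr_powr)
        also have "\<dots> \<le> real p powr e" using False assms by (intro powr_mono2) (auto simp: B_def)
        finally have "2 powr real k \<le> real (p ^ k) powr e" unfolding pk by (intro powr_mono2) auto
        moreover have "real (Suc k) \<le> 2 powr real k"
        proof -
          have "Suc k \<le> 2 ^ k" by (induction k) auto
          then have "real (Suc k) \<le> real (2 ^ k)" by (simp only: of_nat_le_iff)
          then show ?thesis by (simp add: powr_realpow)
        qed
        ultimately have "real (Suc k) \<le> real (p ^ k) powr e" by linarith
        moreover have "C ^ card (S m) \<le> C ^ card (S n)"
          using C(1) sub S_fin by (intro power_increasing card_mono) auto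
        ultimately have "real (Suc k) * C ^ card (S m) \<le> real (p ^ k) powr e * C ^ card (S n)"
          using C(1) by (intro mult_mono) auto
        then show ?thesis by (simp add: mult.commute)
      qed
      then have "real (Suc k) * C ^ card (S m) * real m powr e
          \<le> C ^ card (S n) * real (p ^ k) powr e * real m powr e"
        by (intro mult_right_mono) auto
      also have "\<dots> = C ^ card (S n) * real n powr e"
        using m(1) by (simp add: powr_mult mult.assoc)
      finally have *: "real (Suc k) * (C ^ card (S m) * real m powr e) \<le> C ^ card (S n) * real n powr e"
        by (simp add: mult.assoc)
      have "real (card {d. d dvd n}) \<le> real (Suc k * card {d. d dvd m})"
        unfolding of_nat_le_iff m(1) by (rule card_divisors_prime_power_mult[OF p(1) \<open>0 < m\<close>])
      also have "\<dots> \<le> real (Suc k) * (C ^ card (S m) * real m powr e)"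
        unfolding of_nat_mult by (rule mult_left_mono[OF IH]) simp
      also note *
      finally show ?thesis .
    qed
  qed
  \<comment> \<open>This bound for \<open>card (S n)\<close> depends on \<open>e\<close>
    only.\<close>
  let ?M = "card {p::nat. real p < B}"
  have "real (card {d. d dvd n}) \<le> C ^ ?M * real n powr e" if "0 < n" for n
  proof -
    have "C ^ card (S n) \<le> C ^ ?M"
      using C(1) finS by (intro power_increasing card_mono) (auto simp: S_def)
    then have "C ^ card (S n) * real n powr e \<le> C ^ ?M * real n powr e"
      by (intro mult_right_mono) auto
    then show ?thesis using main[OF that] by linarith
  qed
  moreover have "0 < C ^ ?M" using C(1) by simp
  ultimately show ?thesis by blast
qed

section \<open>Counting\<close>

lemma bounded_int_mats_abs_le:
  assumes "A \<in> bounded_int_mats n H" "i < n" "j < n"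
  shows "\<bar>A $$ (i, j)\<bar> \<le> \<lfloor>H\<rfloor>"
  using assms by (auto simp: bounded_int_mats_def le_floor_iff)

lemma bounded_int_mats_mem:
  assumes "A \<in> bounded_int_mats n H" "i < n" "j < n"
  shows "A $$ (i, j) \<in> {- \<lfloor>H\<rfloor>..\<lfloor>H\<rfloor>}"
  using bounded_int_mats_abs_le[OF assms] by auto

lemma bounded_int_mats_carrier: "A \<in> bounded_int_mats n H \<Longrightarrow> A \<in> carrier_mat n n"
  by (simp add: bounded_int_mats_def)

lemma bounded_int_mats_eqI:
  assumes "A \<in> bounded_int_mats n H" "B \<in> bounded_int_mats n H"
    and "\<And>i j. i < n \<Longrightarrow> j < n \<Longrightarrow> A $$ (i, j) = B $$ (i, j)"
  shows "A = B"
  using assms by (intro eq_matI) (auto simp: bounded_int_mats_def)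

lemma card_kdet_zero_le:
  assumes "2 \<le> n" and f: "monic f" "degree f = n"
  shows "card {A \<in> bounded_int_mats n H. char_poly A = f \<and> kdet n (\<lambda>i j. A $$ (i, j)) = 0}
    \<le> card {- 2 * \<lfloor>H\<rfloor>..2 * \<lfloor>H\<rfloor>} ^ (n * n - n - 1) * (n ^ n * (\<Sum>j<n. j))"
    (is "card ?S \<le> card ?I ^ _ * ?K")
proof -
  \<comment> \<open>Coordinates modulo \<open>U\<close>: the diagonal is dropped, and so is
    \<open>(1, 0)\<close>, which normalizes the subdiagonal.\<close>
  define J where "J = {..<n} \<times> {..<n} - (\<lambda>i. (i, i)) ` {..<n} - {(1, 0)}"
  have cardJ: "card J = n * n - n - 1"
  proof -
    have "card ({..<n} \<times> {..<n} - (\<lambda>i. (i, i)) ` {..<n}) = n * n - n"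
      by (subst card_Diff_subset) (auto simp: card_image inj_on_def)
    then show ?thesis unfolding J_def using assms(1) by (subst card_Diff_singleton) auto
  qed
  \<comment> \<open>Subtracting \<open>A $$ (1, 0)\<close> along the subdiagonal can double the size
    of the entries, hence the interval up to twice the floor of \<open>H\<close>.\<close>
  define red where "red = (\<lambda>A. restrict (\<lambda>(i, j). A $$ (i, j) - (if i = Suc j then A $$ (1, 0) else 0 :: int)) J)"
  have "card ?S \<le> card (PiE J (\<lambda>_. ?I)) * ?K"
  proof (rule card_le_of_fibers[where g = red])
    show "finite ?S" using finite_bounded_int_mats[of n H] by (rule rev_finite_subset) auto
    have "finite J" by (simp add: J_def)
    then show "finite (PiE J (\<lambda>_. ?I))" by (intro finite_PiE) auto
    show "red A \<in> PiE J (\<lambda>_. ?I)" if "A \<in> ?S" for A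
    proof -
      have "\<bar>A $$ (i, j) - (if i = Suc j then A $$ (1, 0) else 0)\<bar> \<le> 2 * \<lfloor>H\<rfloor>" if "i < n" "j < n" for i j
        using bounded_int_mats_abs_le[of A n H i j] bounded_int_mats_abs_le[of A n H 1 0] \<open>A \<in> ?S\<close> that assms(1)
        by auto
      then have *: "A $$ (i, j) - (if i = Suc j then A $$ (1, 0) else 0) \<in> ?I" if "i < n" "j < n" for i j
        using that by (simp only: abs_le_iff atLeastAtMost_iff minus_le_iff mult_minus_left)
      show ?thesis
      proof (rule PiE_I)
        fix p assume "p \<in> J"
        then obtain i j where "p = (i, j)" "i < n" "j < n" by (auto simp: J_def)
        with * show "red A p \<in> ?I" using \<open>p \<in> J\<close> by (simp only: red_def restrict_apply' prod.case)
      qed (simp add: red_def)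
    qed
    fix r
    define F where "F = {A \<in> ?S. red A = r}"
    \<comment> \<open>\<open>u A\<close> holds the coordinates of \<open>A\<close> along
      \<open>U\<close>, and \<open>a\<close> is the representative of the class
      \<open>r\<close>.\<close>
    define u where "u = (\<lambda>A i. if i < n then A $$ (i, i) else if i = n then A $$ (1, 0) else 0 :: int)"
    define a where "a = (\<lambda>i j. if i = j \<or> (i = 1 \<and> j = 0) then 0 else r (i, j) :: int)"
    have ent: "A $$ (i, j) = a i j + shift n (u A) i j" if "A \<in> F" "i < n" "j < n" for A i j
    proof (cases "(i, j) \<in> J")
      case True
      have "r (i, j) = A $$ (i, j) - (if i = Suc j then A $$ (1, 0) else 0)"
        using that(1) True by (auto simp: F_def red_def)
      then show ?thesis using True by (auto simp: a_def shift_def u_def J_def)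
    next
      case False
      then show ?thesis using that by (auto simp: a_def shift_def u_def J_def)
    qed
    have bA: "A \<in> bounded_int_mats n H" if "A \<in> F" for A using that by (simp add: F_def)
    have "inj_on u F"
    proof (rule inj_onI)
      fix A B assume "A \<in> F" "B \<in> F" "u A = u B"
      then show "A = B" using ent[of A] ent[of B] by (intro bounded_int_mats_eqI[OF bA bA]) auto
    qed
    then have "card F = card (u ` F)" by (simp add: card_image)
    also have "\<dots> \<le> ?K"
    proof (rule card_shift_fiber_le[OF f])
      show "finite (u ` F)"
        using finite_bounded_int_mats[of n H] bA by (intro finite_imageI) (auto intro: finite_subset)
      show "v i = 0" if "v \<in> u ` F" "n < i" for v i using that by (auto simp: u_def)
      show "char_poly (mat n n (\<lambda>(i, j). a i j + shift n v i j)) = f" if "v \<in> u ` F" for v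
      proof -
        from that obtain A where A: "A \<in> F" "v = u A" by blast
        have "mat n n (\<lambda>(i, j). a i j + shift n v i j) = A"
          using ent[OF A(1)] A(2) bounded_int_mats_carrier[OF bA[OF A(1)]] by (intro eq_matI) auto
        then show ?thesis using A(1) by (simp add: F_def)
      qed
      show "kdet n (\<lambda>i j. a i j + shift n v i j) = 0" if "v \<in> u ` F" for v
      proof -
        from that obtain A where A: "A \<in> F" "v = u A" by blast
        have "kdet n (\<lambda>i j. a i j + shift n v i j) = kdet n (\<lambda>i j. A $$ (i, j))"
          using ent[OF A(1)] A(2) by (intro kdet_cong) auto
        then show ?thesis using A(1) by (simp add: F_def)
      qed
    qed
    finally show "card {A \<in> ?S. red A = r} \<le> ?K" by (simp add: F_def)
  qed
  also have "card (PiE J (\<lambda>_. ?I)) = card ?I ^ card J"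
    by (subst card_PiE) (simp_all add: J_def)
  also note cardJ
  finally show ?thesis .
qed

text \<open>Transposition preserves the entry bound and the characteristic polynomial.\<close>

lemma card_kdet_transpose_zero_le:
  assumes "2 \<le> n" and f: "monic f" "degree f = n"
  shows "card {A \<in> bounded_int_mats n H. char_poly A = f \<and> kdet n (\<lambda>i j. A $$ (j, i)) = 0}
    \<le> card {- 2 * \<lfloor>H\<rfloor>..2 * \<lfloor>H\<rfloor>} ^ (n * n - n - 1) * (n ^ n * (\<Sum>j<n. j))"
    (is "card ?S \<le> _")
proof -
  let ?T = "{A \<in> bounded_int_mats n H. char_poly A = f \<and> kdet n (\<lambda>i j. A $$ (i, j)) = 0}"
  have "card ?S \<le> card ?T"
  proof (rule card_inj_on_le[where f = transpose_mat])
    show "inj_on transpose_mat ?S" by (rule inj_onI) (metis transpose_transpose)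
    show "finite ?T" using finite_bounded_int_mats[of n H] by (rule rev_finite_subset) auto
    show "transpose_mat ` ?S \<subseteq> ?T"
    proof
      fix B assume "B \<in> transpose_mat ` ?S"
      then obtain A where A: "A \<in> ?S" "B = transpose_mat A" by blast
      then have Ac: "A \<in> carrier_mat n n" by (simp add: bounded_int_mats_def)
      have "kdet n (\<lambda>i j. B $$ (i, j)) = kdet n (\<lambda>i j. A $$ (j, i))"
        using A(2) Ac by (intro kdet_cong) auto
      then show "B \<in> ?T"
        using A Ac by (auto simp: bounded_int_mats_def char_poly_transpose_mat[OF Ac])
    qed
  qed
  also note card_kdet_zero_le[OF assms]
  finally show ?thesis .
qed

lemma card_int_divisors_le:
  assumes "(k::int) \<noteq> 0"
  shows "finite {d. d dvd k}" "card {d. d dvd k} \<le> 2 * card {d. d dvd nat \<bar>k\<bar>}"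
proof -
  let ?S = "{d. d dvd nat \<bar>k\<bar>}"
  have fin: "finite ?S" using assms by (intro finite_divisors_nat) auto
  have sub: "{d. d dvd k} \<subseteq> int ` ?S \<union> (\<lambda>d. - int d) ` ?S"
  proof
    fix d assume "d \<in> {d. d dvd k}"
    then have "nat \<bar>d\<bar> \<in> ?S" by (simp add: nat_dvd_iff)
    moreover have "d = int (nat \<bar>d\<bar>) \<or> d = - int (nat \<bar>d\<bar>)" by auto
    ultimately show "d \<in> int ` ?S \<union> (\<lambda>d. - int d) ` ?S" by blast
  qed
  then show "finite {d. d dvd k}" using fin finite_subset by blast
  have "card {d. d dvd k} \<le> card (int ` ?S \<union> (\<lambda>d. - int d) ` ?S)"
    using sub fin by (intro card_mono) auto
  also have "\<dots> \<le> card (int ` ?S) + card ((\<lambda>d. - int d) ` ?S)" by (rule card_Un_le)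
  also have "\<dots> \<le> card ?S + card ?S" using fin by (intro add_mono card_image_le)
  finally show "card {d. d dvd k} \<le> 2 * card ?S" by simp
qed

text \<open>For fixed minor, the product of the Krylov determinants of \<open>A\<close> and of its transpose is a Hankel
  determinant depending only on \<open>f\<close>, so \<open>kdet n A\<close> is one of its divisors. The minor, the value of
  \<open>kdet n A\<close> and the first column determine \<open>A\<close>.\<close>

lemma card_kdet_nonzero_le:
  assumes "2 \<le> n" "1 \<le> H"
    and div: "\<And>k. k \<noteq> 0 \<Longrightarrow> \<bar>k\<bar> \<le> (fact n * (int n * \<lfloor>H\<rfloor>) ^ (n * n))\<^sup>2 \<Longrightarrow> card {d. d dvd k} \<le> \<tau>"
  shows "card {A \<in> bounded_int_mats n H. char_poly A = f \<and>
      kdet n (\<lambda>i j. A $$ (i, j)) \<noteq> 0 \<and> kdet n (\<lambda>i j. A $$ (j, i)) \<noteq> 0}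
    \<le> card {- \<lfloor>H\<rfloor>..\<lfloor>H\<rfloor>} ^ ((n - 1) * (n - 1)) * (\<tau> * ((n - 1) * (card {- \<lfloor>H\<rfloor>..\<lfloor>H\<rfloor>} ^ (n - 2) * (n * n))))"
    (is "card ?G \<le> card ?I ^ _ * (\<tau> * ?L)")
proof -
  let ?P = "\<lambda>A. kdet n (\<lambda>i j. A $$ (i, j))" and ?Q = "\<lambda>A. kdet n (\<lambda>i j. A $$ (j, i))"
  define J where "J = {1..<n} \<times> {1..<n}"
  define minor where "minor = (\<lambda>A::int mat. restrict (\<lambda>p. A $$ p) J)"
  have finG: "finite ?G" using finite_bounded_int_mats[of n H] by (rule rev_finite_subset) auto
  have h: "1 \<le> \<lfloor>H\<rfloor>" using assms(2) by simp
  have "card ?G \<le> card (PiE J (\<lambda>_. ?I)) * (\<tau> * ?L)"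
  proof (rule card_le_of_fibers[OF finG, where g = minor])
    show "finite (PiE J (\<lambda>_. ?I))" by (intro finite_PiE) (auto simp: J_def)
    show "minor A \<in> PiE J (\<lambda>_. ?I)" if "A \<in> ?G" for A
    proof (rule PiE_I)
      fix p assume "p \<in> J"
      then obtain i j where "p = (i, j)" "i < n" "j < n" by (auto simp: J_def)
      with bounded_int_mats_mem[of A n H i j] that show "minor A p \<in> ?I"
        using \<open>p \<in> J\<close> by (simp add: minor_def)
    qed (simp add: minor_def)
    fix r
    define F where "F = {A \<in> ?G. minor A = r}"
    have ent: "A $$ (i, j) = B $$ (i, j)"
      if "A \<in> F" "B \<in> F" "0 < i" "i < n" "0 < j" "j < n" for A B i j
    proof -
      have "minor A (i, j) = minor B (i, j)" using that by (simp add: F_def)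
      then show ?thesis using that by (simp add: minor_def J_def)
    qed
    have moments: "kry n (\<lambda>i j. A $$ (i, j)) k 0 = kry n (\<lambda>i j. B $$ (i, j)) k 0"
      if "A \<in> F" "B \<in> F" for A B k
    proof (rule moments_eq)
      show "A \<in> carrier_mat n n" "B \<in> carrier_mat n n"
        using that by (auto simp: F_def bounded_int_mats_carrier)
      show "char_poly A = char_poly B" using that by (simp add: F_def)
    qed (use assms(1) ent[OF that] in auto)
    show "card {A \<in> ?G. minor A = r} \<le> \<tau> * ?L"
    proof (cases "F = {}")
      case True
      then show ?thesis unfolding F_def by (simp only: card.empty le0)
    next
      case False
      then obtain A0 where A0: "A0 \<in> F" by blast
      \<comment> \<open>The Hankel determinant shared by the whole fibre, since the moments are
        constant on it.\<close>
      define \<Delta> where "\<Delta> = ?Q A0 * ?P A0"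
      have \<Delta>: "?Q A * ?P A = \<Delta>" if "A \<in> F" for A
        using kdet_hankel[of n "\<lambda>i j. A $$ (i, j)"] kdet_hankel[of n "\<lambda>i j. A0 $$ (i, j)"] assms(1)
          moments[OF that A0] by (simp add: \<Delta>_def)
      have "\<Delta> \<noteq> 0" using A0 by (simp add: \<Delta>_def F_def)
      have A0b: "A0 \<in> bounded_int_mats n H" using A0 by (simp add: F_def)
      have "\<bar>\<Delta>\<bar> \<le> (fact n * (int n * \<lfloor>H\<rfloor>) ^ (n * n)) * (fact n * (int n * \<lfloor>H\<rfloor>) ^ (n * n))"
        unfolding \<Delta>_def abs_mult using bounded_int_mats_abs_le[OF A0b] h assms(1)
        by (intro mult_mono abs_kdet_le) auto
      then have "card {d. d dvd \<Delta>} \<le> \<tau>" using \<open>\<Delta> \<noteq> 0\<close> by (intro div) (simp_all add: power2_eq_square)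
      have finF: "finite F" using finG by (rule rev_finite_subset) (auto simp: F_def)
      have "card F \<le> card {d. d dvd \<Delta>} * ?L"
      proof (rule card_le_of_fibers[OF finF, where g = ?P])
        show "finite {d. d dvd \<Delta>}" by (rule card_int_divisors_le(1)[OF \<open>\<Delta> \<noteq> 0\<close>])
        show "?P A \<in> {d. d dvd \<Delta>}" if "A \<in> F" for A using \<Delta>[OF that] by (metis dvd_triv_right mem_Collect_eq)
        fix D assume "D \<in> {d. d dvd \<Delta>}"
        then have "D \<noteq> 0" using \<open>\<Delta> \<noteq> 0\<close> by auto
        define M where "M = (\<lambda>i j. A0 $$ (i, j))"
        define column where "column = (\<lambda>A::int mat. restrict (\<lambda>i. A $$ (Suc i, 0)) {..<n - 1})"
        let ?V = "{c \<in> PiE {..<n - 1} (\<lambda>_. ?I). kdet n (column_mat M (\<lambda>i. if i < n - 1 then c i else 0)) = D}"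
        have "card {A \<in> F. ?P A = D} \<le> card ?V"
        proof (rule card_inj_on_le[where f = column])
          have "finite (PiE {..<n - 1} (\<lambda>_. ?I))" by (intro finite_PiE) auto
          then show "finite ?V" by (rule rev_finite_subset) auto
          show "inj_on column {A \<in> F. ?P A = D}"
          proof (rule inj_onI)
            fix A B assume A: "A \<in> {A \<in> F. ?P A = D}" and B: "B \<in> {A \<in> F. ?P A = D}"
              and col: "column A = column B"
            have c: "A $$ (i, 0) = B $$ (i, 0)" if "0 < i" "i < n" for i
              using fun_cong[OF col, of "i - 1"] that by (cases i) (simp_all add: column_def less_diff_conv)
            \<comment> \<open>Minor and first column give every row below the first; the moments
              then give row \<open>0\<close>.\<close>
            have "A $$ (i, j) = B $$ (i, j)" if "i < n" "j < n" for i j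
            proof (rule kdet_inj[of n "\<lambda>i j. A $$ (i, j)" "\<lambda>i j. B $$ (i, j)"])
              show "?P A \<noteq> 0" using A by (auto simp: F_def)
              show "A $$ (i, j) = B $$ (i, j)" if "0 < i" "i < n" "j < n" for i j
                using that c[of i] ent[of A B i j] A B by (cases "j = 0") auto
              show "kry n (\<lambda>i j. A $$ (i, j)) k 0 = kry n (\<lambda>i j. B $$ (i, j)) k 0" for k
                using moments A B by auto
            qed (use that in auto)
            then show "A = B" using A B by (intro bounded_int_mats_eqI[of A n H B]) (auto simp: F_def)
          qed
          show "column ` {A \<in> F. ?P A = D} \<subseteq> ?V"
          proof
            fix c assume "c \<in> column ` {A \<in> F. ?P A = D}"
            then obtain A where A: "A \<in> F" "?P A = D" "c = column A" by blast
            have "A $$ (Suc i, 0) \<in> ?I" if "i < n - 1" for i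
              using A(1) that by (intro bounded_int_mats_mem[of A n H]) (auto simp: F_def)
            then have "c \<in> PiE {..<n - 1} (\<lambda>_. ?I)"
              unfolding A(3) column_def restrict_PiE_iff by blast
            moreover have "kdet n (column_mat M (\<lambda>i. if i < n - 1 then c i else 0))
                = kdet n (\<lambda>i j. if i = 0 then 0 else A $$ (i, j))"
              using ent[OF A(1) A0] by (intro kdet_cong) (auto simp: column_mat_def A(3) column_def M_def)
            ultimately show "c \<in> ?V" using A(2) kdet_zero_row[of n "\<lambda>i j. A $$ (i, j)"] by simp
          qed
        qed
        also have "\<dots> \<le> ?L" by (rule card_kdet_level_set_le[OF assms(1) \<open>D \<noteq> 0\<close>]) simp
        finally show "card {A \<in> F. ?P A = D} \<le> ?L" .
      qed
      also have "\<dots> \<le> \<tau> * ?L" using \<open>card {d. d dvd \<Delta>} \<le> \<tau>\<close> by (rule mult_le_mono1)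
      finally show ?thesis by (simp add: F_def)
    qed
  qed
  also have "card (PiE J (\<lambda>_. ?I)) = card ?I ^ ((n - 1) * (n - 1))"
    by (subst card_PiE) (auto simp: J_def)
  finally show ?thesis .
qed

section \<open>Combining the three counts\<close>

lemma real_card_symmetric_interval_le:
  assumes "1 \<le> H" "0 \<le> k"
  shows "real (card {- k * \<lfloor>H\<rfloor>..k * \<lfloor>H\<rfloor>}) \<le> (2 * real_of_int k + 1) * H"
proof -
  have h: "0 \<le> k * \<lfloor>H\<rfloor>" using assms by simp
  then have "card {- k * \<lfloor>H\<rfloor>..k * \<lfloor>H\<rfloor>} = nat (2 * (k * \<lfloor>H\<rfloor>) + 1)" by simp
  then have "real (card {- k * \<lfloor>H\<rfloor>..k * \<lfloor>H\<rfloor>}) = 2 * (real_of_int k * real_of_int \<lfloor>H\<rfloor>) + 1"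
    using h by simp
  also have "\<dots> \<le> 2 * (real_of_int k * H) + H"
    using assms by (intro add_mono mult_left_mono) auto
  finally show ?thesis by (simp add: algebra_simps)
qed

lemma num_mats_char_poly_le:
  assumes "2 \<le> n" "0 < (\<epsilon>::real)"
  shows "\<exists>C>0. \<forall>H\<ge>1. \<forall>f. monic f \<and> degree f = n \<longrightarrow>
    real (num_mats_char_poly n H f) \<le> C * H powr (real n ^ 2 - real n - 1 + \<epsilon>)"
proof -
  define e where "e = n * n - n - 1"
  \<comment> \<open>The Hankel determinant is at most \<open>B\<close> times the power
    \<open>2 * (n * n)\<close> of \<open>H\<close>, so raising this to \<delta> costs exactly
    \<open>H powr \<epsilon>\<close>.\<close>
  define \<delta> where "\<delta> = \<epsilon> / real (2 * (n * n))"
  define B where "B = (fact n * real n ^ (n * n))\<^sup>2"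
  have "0 < \<delta>" using assms by (simp add: \<delta>_def)
  then obtain C1 where C1: "0 < C1" "\<And>k. 0 < k \<Longrightarrow> real (card {d::nat. d dvd k}) \<le> C1 * real k powr \<delta>"
    using divisor_bound by blast
  define K where "K = real (n ^ n * (\<Sum>j<n. j))"
  define L where "L = real ((n - 1) * (n * n)) * (2 * C1 * B powr \<delta>)"
  \<comment> \<open>The \<open>2\<close> accounts for \<open>P = 0\<close> and \<open>Q = 0\<close>,
    while \<open>5\<close> and \<open>3\<close> come from intervals with at most
    \<open>5 * H\<close> and \<open>3 * H\<close> elements. The summand \<open>1\<close> makes
    \<open>C\<close> positive.\<close>
  define C where "C = 2 * 5 ^ e * K + 3 ^ e * L + 1"
  have "0 \<le> K" "0 \<le> L" using C1(1) unfolding K_def L_def by (simp_all only: of_nat_0_le_iff) simp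
  have nn: "n + 1 \<le> n * n" using assms(1) mult_le_mono1[of 2 n n] by linarith
  have real_e: "real e = real n ^ 2 - real n - 1"
    using nn by (simp add: e_def of_nat_diff power2_eq_square)
  have bound: "real (num_mats_char_poly n H f) \<le> C * H powr (real e + \<epsilon>)"
    if "1 \<le> H" and f: "monic f" "degree f = n" for H f
  proof -
    let ?P = "{A \<in> bounded_int_mats n H. char_poly A = f \<and> kdet n (\<lambda>i j. A $$ (i, j)) = 0}"
    let ?Q = "{A \<in> bounded_int_mats n H. char_poly A = f \<and> kdet n (\<lambda>i j. A $$ (j, i)) = 0}"
    let ?G = "{A \<in> bounded_int_mats n H. char_poly A = f \<and>
      kdet n (\<lambda>i j. A $$ (i, j)) \<noteq> 0 \<and> kdet n (\<lambda>i j. A $$ (j, i)) \<noteq> 0}"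
    let ?I = "{- \<lfloor>H\<rfloor>..\<lfloor>H\<rfloor>}" and ?J = "{- 2 * \<lfloor>H\<rfloor>..2 * \<lfloor>H\<rfloor>}"
    define X where "X = (fact n * (real n * H) ^ (n * n))\<^sup>2"
    define \<tau> where "\<tau> = nat \<lfloor>2 * C1 * X powr \<delta>\<rfloor>"
    have \<tau>: "card {d. d dvd k} \<le> \<tau>"
      if k: "k \<noteq> 0" "\<bar>k\<bar> \<le> (fact n * (int n * \<lfloor>H\<rfloor>) ^ (n * n))\<^sup>2" for k
    proof -
      have "real (nat \<bar>k\<bar>) = real_of_int \<bar>k\<bar>" by simp
      also have "\<dots> \<le> real_of_int ((fact n * (int n * \<lfloor>H\<rfloor>) ^ (n * n))\<^sup>2)" using k(2) by (simp only: of_int_le_iff)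
      also have "\<dots> = (fact n * (real n * real_of_int \<lfloor>H\<rfloor>) ^ (n * n))\<^sup>2" by simp
      also have "\<dots> \<le> X"
        unfolding X_def using \<open>1 \<le> H\<close> by (intro power_mono mult_left_mono mult_nonneg_nonneg zero_le_power) auto
      finally have "real (nat \<bar>k\<bar>) powr \<delta> \<le> X powr \<delta>" using \<open>0 < \<delta>\<close> by (intro powr_mono2) auto
      then have "C1 * real (nat \<bar>k\<bar>) powr \<delta> \<le> C1 * X powr \<delta>" using C1(1) by (intro mult_left_mono) auto
      moreover have "real (card {d. d dvd nat \<bar>k\<bar>}) \<le> C1 * real (nat \<bar>k\<bar>) powr \<delta>" by (rule C1(2)) (use k(1) in simp)
      moreover have "real (card {d. d dvd k}) \<le> 2 * real (card {d. d dvd nat \<bar>k\<bar>})"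
        using card_int_divisors_le(2)[OF k(1)] by linarith
      ultimately have "real (card {d. d dvd k}) \<le> 2 * C1 * X powr \<delta>" by linarith
      then show ?thesis unfolding \<tau>_def by (simp add: le_nat_floor)
    qed
    have X: "X powr \<delta> = B powr \<delta> * H powr \<epsilon>"
    proof -
      have "X = B * H ^ (2 * (n * n))"
        by (simp add: X_def B_def power_mult_distrib power_mult[symmetric] mult.commute)
      also have "H ^ (2 * (n * n)) = H powr real (2 * (n * n))"
        using \<open>1 \<le> H\<close> by (simp only: powr_realpow)
      finally show ?thesis
        using assms by (simp add: powr_mult powr_powr \<delta>_def B_def)
    qed
    have "real \<tau> \<le> 2 * C1 * X powr \<delta>" using C1(1) by (simp add: \<tau>_def)
    then have \<tau>_le: "real \<tau> \<le> 2 * C1 * B powr \<delta> * H powr \<epsilon>" by (simp add: X mult.assoc)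
    have cI: "real (card ?I) \<le> 3 * H" using real_card_symmetric_interval_le[OF \<open>1 \<le> H\<close>, of 1] by simp
    have cJ: "real (card ?J) \<le> 5 * H" using real_card_symmetric_interval_le[OF \<open>1 \<le> H\<close>, of 2] by simp
    have He: "H ^ e * H powr \<epsilon> = H powr (real e + \<epsilon>)" "H ^ e \<le> H powr (real e + \<epsilon>)"
    proof -
      have pe: "H ^ e = H powr real e" using \<open>1 \<le> H\<close> by (simp add: powr_realpow)
      show "H ^ e * H powr \<epsilon> = H powr (real e + \<epsilon>)" by (simp add: pe powr_add)
      show "H ^ e \<le> H powr (real e + \<epsilon>)" unfolding pe using assms(2) \<open>1 \<le> H\<close> by (intro powr_mono) auto
    qed
    have bad: "real m \<le> 5 ^ e * K * H powr (real e + \<epsilon>)"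
      if "m \<le> card ?J ^ (n * n - n - 1) * (n ^ n * (\<Sum>j<n. j))" for m
    proof -
      have "real m \<le> real (card ?J ^ e * (n ^ n * (\<Sum>j<n. j)))"
        using that unfolding e_def by (simp only: of_nat_le_iff)
      also have "\<dots> = real (card ?J) ^ e * K" by (simp only: K_def of_nat_mult of_nat_power)
      also have "\<dots> \<le> (5 * H) ^ e * K" using cJ \<open>0 \<le> K\<close> by (intro mult_right_mono power_mono) auto
      also have "\<dots> = 5 ^ e * K * H ^ e" by (simp add: power_mult_distrib)
      also have "\<dots> \<le> 5 ^ e * K * H powr (real e + \<epsilon>)" using He(2) \<open>0 \<le> K\<close> by (intro mult_left_mono) auto
      finally show ?thesis .
    qed
    have good: "real (card ?G) \<le> 3 ^ e * L * H powr (real e + \<epsilon>)"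
    proof -
      \<comment> \<open>The first exponent comes from the minor, the second from the level set of
        first columns.\<close>
      have exps: "(n - 1) * (n - 1) + (n - 2) = e"
      proof -
        obtain m where "n = m + 2" using assms(1) by (metis le_add_diff_inverse2)
        then show ?thesis by (simp add: e_def algebra_simps)
      qed
      have "card ?G \<le> card ?I ^ ((n - 1) * (n - 1)) * (\<tau> * ((n - 1) * (card ?I ^ (n - 2) * (n * n))))"
        by (rule card_kdet_nonzero_le[OF assms(1) \<open>1 \<le> H\<close> \<tau>])
      also have "\<dots> = card ?I ^ e * (((n - 1) * (n * n)) * \<tau>)"
        unfolding exps[symmetric] power_add by (simp only: mult_ac)
      finally have "real (card ?G) \<le> real (card ?I ^ e * (((n - 1) * (n * n)) * \<tau>))" by (simp only: of_nat_le_iff)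
      also have "\<dots> = real (card ?I) ^ e * (real ((n - 1) * (n * n)) * real \<tau>)"
        by (simp only: of_nat_mult of_nat_power)
      also have "\<dots> \<le> (3 * H) ^ e * (real ((n - 1) * (n * n)) * (2 * C1 * B powr \<delta> * H powr \<epsilon>))"
        using cI \<tau>_le \<open>1 \<le> H\<close> by (intro mult_mono power_mono mult_nonneg_nonneg zero_le_power) auto
      also have "\<dots> = 3 ^ e * L * (H ^ e * H powr \<epsilon>)" by (simp add: L_def power_mult_distrib)
      finally show ?thesis by (simp only: He(1))
    qed
    have "{A \<in> bounded_int_mats n H. char_poly A = f} = ?P \<union> ?Q \<union> ?G" by blast
    then have "num_mats_char_poly n H f \<le> card ?P + card ?Q + card ?G"
      unfolding num_mats_char_poly_def by (metis (no_types, lifting) add_right_mono card_Un_le le_trans)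
    then have "real (num_mats_char_poly n H f) \<le> real (card ?P) + real (card ?Q) + real (card ?G)"
      by linarith
    also have "\<dots> \<le> 5 ^ e * K * H powr (real e + \<epsilon>) + 5 ^ e * K * H powr (real e + \<epsilon>)
        + 3 ^ e * L * H powr (real e + \<epsilon>)"
      using bad[OF card_kdet_zero_le[OF assms(1) f]] bad[OF card_kdet_transpose_zero_le[OF assms(1) f]] good
      by (intro add_mono)
    also have "\<dots> \<le> C * H powr (real e + \<epsilon>)" by (simp add: C_def algebra_simps)
    finally show ?thesis .
  qed
  have "0 < C" using \<open>0 \<le> K\<close> \<open>0 \<le> L\<close> by (simp add: C_def add_nonneg_pos)
  then show ?thesis using bound unfolding real_e by blast
qed

section \<open>From the count to the exponent\<close>

lemma admissible_saving_one:
  assumes "2 \<le> n"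
  shows "admissible_saving n 1"
  unfolding admissible_saving_def
proof (intro allI impI)
  fix \<epsilon> :: real assume "0 < \<epsilon>"
  define E where "E = real n ^ 2 - real n - 1"
  obtain C where C: "0 < C" "\<And>H f. 1 \<le> H \<Longrightarrow> monic f \<and> degree f = n \<Longrightarrow>
      real (num_mats_char_poly n H f) \<le> C * H powr (E + \<epsilon> / 2)"
    using num_mats_char_poly_le[OF assms, of "\<epsilon> / 2"] \<open>0 < \<epsilon>\<close> unfolding E_def by (metis half_gt_zero)
  show "\<exists>H\<^sub>0\<ge>1. \<forall>H\<ge>H\<^sub>0. \<forall>f. monic f \<and> degree f = n \<longrightarrow>
      real (num_mats_char_poly n H f) \<le> H powr (real n ^ 2 - real n - 1 + \<epsilon>)"
  \<comment> \<open>Beyond this threshold \<open>C <= H powr (\<epsilon> / 2)\<close>; the other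
    half of \<epsilon> is used in the count.\<close>
  proof (intro exI[of _ "max 1 (C powr (2 / \<epsilon>))"] conjI allI impI)
    fix H :: real and f :: "int poly"
    assume H: "max 1 (C powr (2 / \<epsilon>)) \<le> H" and f: "monic f \<and> degree f = n"
    have "C = (C powr (2 / \<epsilon>)) powr (\<epsilon> / 2)" using C(1) \<open>0 < \<epsilon>\<close> by (simp add: powr_powr)
    also have "\<dots> \<le> H powr (\<epsilon> / 2)" using H \<open>0 < \<epsilon>\<close> by (intro powr_mono2) auto
    finally have "C * H powr (E + \<epsilon> / 2) \<le> H powr (\<epsilon> / 2) * H powr (E + \<epsilon> / 2)"
      by (intro mult_right_mono) auto
    also have "\<dots> = H powr (E + \<epsilon>)" by (simp add: add.commute flip: powr_add)
    finally show "real (num_mats_char_poly n H f) \<le> H powr (real n ^ 2 - real n - 1 + \<epsilon>)"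
      using C(2)[of H f] H f unfolding E_def by auto
  qed simp
qed

text \<open>The zero matrix is always counted for its own characteristic polynomial, so the exponent
  cannot be negative. This bounds the admissible savings from above.\<close>

lemma admissible_saving_le:
  assumes "admissible_saving n g"
  shows "g \<le> real n ^ 2 - real n + 1"
proof -
  have "(1::real) > 0" by simp
  then obtain H0 where H0: "\<And>H f. H0 \<le> H \<Longrightarrow> monic f \<and> degree f = n \<Longrightarrow>
      real (num_mats_char_poly n H f) \<le> H powr (real n ^ 2 - real n - g + 1)"
    using assms unfolding admissible_saving_def by blast
  \<comment> \<open>\<open>H\<close> must exceed \<open>1\<close> strictly for a negative exponent
    to give a value below \<open>1\<close>.\<close>
  define H where "H = max H0 2"
  define f where "f = char_poly (0\<^sub>m n n :: int mat)"
  have "0\<^sub>m n n \<in> {A \<in> bounded_int_mats n H. char_poly A = f}"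
    by (simp add: bounded_int_mats_def f_def H_def max.coboundedI2)
  moreover have "finite {A \<in> bounded_int_mats n H. char_poly A = f}"
    using finite_bounded_int_mats[of n H] by (rule rev_finite_subset) auto
  ultimately have "1 \<le> num_mats_char_poly n H f"
    unfolding num_mats_char_poly_def by (metis One_nat_def Suc_leI card_gt_0_iff empty_iff)
  moreover have "monic f \<and> degree f = n"
    using degree_monic_char_poly[of "0\<^sub>m n n :: int mat" n] by (simp add: f_def)
  then have "real (num_mats_char_poly n H f) \<le> H powr (real n ^ 2 - real n - g + 1)"
    by (intro H0) (simp add: H_def)
  ultimately have "1 \<le> H powr (real n ^ 2 - real n - g + 1)" by linarith
  moreover have "H powr (real n ^ 2 - real n - g + 1) < 1" if "real n ^ 2 - real n - g + 1 < 0"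
    using powr_less_mono[OF that, of H] by (simp add: H_def)
  ultimately show ?thesis by linarith
qed

text \<open>\<open>GREATEST\<close> has its intended meaning only if a maximum exists. The supremum
  is attained because the definition allows a loss of \<epsilon>: half of it covers the distance to
  an admissible \<open>s\<close>, the other half is the loss allowed for \<open>s\<close>.\<close>

lemma gamma_exponent_ge:
  assumes "admissible_saving n g"
  shows "g \<le> gamma_exponent n"
proof -
  let ?S = "{g. admissible_saving n g}"
  have bdd: "bdd_above ?S" by (rule bdd_aboveI) (use admissible_saving_le in blast)
  define \<sigma> where "\<sigma> = Sup ?S"
  have "admissible_saving n \<sigma>"
    unfolding admissible_saving_def
  proof (intro allI impI)
    fix \<epsilon> :: real assume "0 < \<epsilon>"
    then have "\<exists>s\<in>?S. \<sigma> - \<epsilon> / 2 < s"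
      unfolding \<sigma>_def using assms bdd by (subst less_cSup_iff[symmetric]) auto
    then obtain s where s: "admissible_saving n s" "\<sigma> - \<epsilon> / 2 < s" by blast
    obtain H0 where H0: "1 \<le> H0" "\<And>H f. H0 \<le> H \<Longrightarrow> monic f \<and> degree f = n \<Longrightarrow>
        real (num_mats_char_poly n H f) \<le> H powr (real n ^ 2 - real n - s + \<epsilon> / 2)"
      using s(1) \<open>0 < \<epsilon>\<close> unfolding admissible_saving_def by (meson half_gt_zero)
    have "real (num_mats_char_poly n H f) \<le> H powr (real n ^ 2 - real n - \<sigma> + \<epsilon>)"
      if "H0 \<le> H" "monic f \<and> degree f = n" for H f
    proof -
      have "H powr (real n ^ 2 - real n - s + \<epsilon> / 2) \<le> H powr (real n ^ 2 - real n - \<sigma> + \<epsilon>)"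
        using s(2) H0(1) that(1) by (intro powr_mono) auto
      then show ?thesis using H0(2)[OF that] by linarith
    qed
    then show "\<exists>H\<^sub>0\<ge>1. \<forall>H\<ge>H\<^sub>0. \<forall>f. monic f \<and> degree f = n \<longrightarrow>
        real (num_mats_char_poly n H f) \<le> H powr (real n ^ 2 - real n - \<sigma> + \<epsilon>)"
      using H0(1) by blast
  qed
  moreover have "s \<le> \<sigma>" if "admissible_saving n s" for s 
    unfolding \<sigma>_def using that bdd by (simp add: cSup_upper)
  ultimately have "gamma_exponent n = \<sigma>" "g \<le> \<sigma>"
    unfolding gamma_exponent_def using assms by (auto intro: Greatest_equality)
  then show ?thesis by simp
qed

theorem theorem2p2:
  fixes n :: nat
  assumes "n \<ge> 4"
  shows "gamma_exponent n \<ge> 1"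
  using admissible_saving_one[of n] assms by (intro gamma_exponent_ge) simp

end
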